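(* Let $n\in\mathbb{N}$, $\hbar\in{]0,\infty[}$ and $\mu\in{[0,\infty[}$. Let $\mathcal{B}_\hbar=\bigoplus_{k\in\mathbb{N}_0}\mathscr{P}^{k,k}(\mathbb{C}^{1+n})$ with product $\star_\hbar$ and pointwise complex conjugation as involution, and let $\langle\mathcal{J}-\mu\rangle$ be the $^*$-ideal of $\mathcal{B}_\hbar$ generated by $\mathcal{J}-\mu\mathbb{1}$ with respect to $\star_\hbar$. Then $$\mathcal{R}_{\hbar,\mu}=(\mathcal{B}_\hbar)^{++}_{\mathrm H}+\big(\langle\mathcal{J}-\mu\rangle\big)_{\mathrm H}.$$ Equivalently: every $f\in(\mathcal{B}_\hbar)_{\mathrm H}$ such that $\langle\psi,\pi_\hbar(f)\psi\rangle_\hbar\ge 0$ for all $\psi$ in the Fock space with $\pi_\hbar(\mathcal{J})\psi=\mu\psi$ can be written as $f=\sum_{j=1}^{\ell}\overline{g_j}\star_\hbar g_j+(\mathcal{J}-\mu\mathbb{1})\star_\hbar h$ with $\ell\in\mathbb{N}_0$, $g_j\in\mathcal{B}_\hbar$, $h\in(\mathcal{B}_\hbar)_{\mathrm H}$; conversely every element of the right-hand side lies in $\mathcal{R}_{\hbar,\mu}$.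
   Context: $z_0,\dots,z_n,\overline{z_0},\dots,\overline{z_n}$ are the complex coordinates on $\mathbb{C}^{1+n}$ and their conjugates; for $K\in\mathbb{N}_0^{1+n}$, $z^K=z_0^{K_0}\cdots z_n^{K_n}$, $\overline{z}^K$ analogously, $|K|=\sum K_i$, $K!=\prod K_i!$. $\mathscr{P}^{k,\ell}(\mathbb{C}^{1+n})$ is the complex span of the $z^K\overline{z}^L$ with $|K|=k$, $|L|=\ell$, and $\mathscr{P}(\mathbb{C}^{1+n})=\bigoplus_{k,\ell}\mathscr{P}^{k,\ell}(\mathbb{C}^{1+n})$ is the space of complex polynomials on $\mathbb{C}^{1+n}$. The Wick star product is $f\star_\hbar g=\sum_{K\in\mathbb{N}_0^{1+n}}\frac{\hbar^{|K|}}{K!}\frac{\partial^{|K|}f}{\partial\overline{z}^K}\frac{\partial^{|K|}g}{\partial z^K}$; with pointwise complex conjugation as $^*$ this is a unital $^*$-algebra (unit the constant function $\mathbb{1}$). Juxtaposition of polynomials means pointwise product. $\mathcal{J}=\sum_{j=0}^n z_j\overline{z_j}$. For a $^*$-algebra $A$, $A_{\mathrm H}=\{a:a=a^*\}$, $A^{++}_{\mathrm H}$ is the set of finite sums $\sum a_j^*a_j$, and for a subset $S$, $S_{\mathrm H}=S\cap A_{\mathrm H}$. The Fock space is the space of holomorphic polynomials $\bigoplus_k\mathscr{P}^{k,0}(\mathbb{C}^{1+n})$ with inner product $\langle z^K,z^L\rangle_\hbar=\delta_{K,L}\hbar^{|K|}K!$ (antilinear in the first argument), and $\pi_\hbar$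 is the $^*$-representation of $(\mathscr{P}(\mathbb{C}^{1+n}),\star_\hbar)$ on it given by $\pi_\hbar(z^K\overline{z}^L)=z^K\hbar^{|L|}\frac{\partial^{|L|}}{\partial z^L}$. $\mathcal{B}_\hbar$ (which equals the commutant of $\mathcal{J}$ in $(\mathscr{P}(\mathbb{C}^{1+n}),\star_\hbar)$) is ordered by $\mathcal{B}^+_\hbar=\{f\in(\mathcal{B}_\hbar)_{\mathrm H}:\langle g,\pi_\hbar(f)g\rangle_\hbar\ge0\text{ for all }g\text{ in the Fock space}\}$. A state on $\mathcal{B}_\hbar$ is a linear $\omega:\mathcal{B}_\hbar\to\mathbb{C}$ with $\omega(\mathbb{1})=1$, $\omega$ real on Hermitian elements and $\omega\ge0$ on $\mathcal{B}^+_\hbar$. $\mathcal{R}_{\hbar,\mu}$ is the set of $f\in(\mathcal{B}_\hbar)_{\mathrm H}$ with $\omega(f)\ge0$ for every state $\omega$ on $\mathcal{B}_\hbar$ satisfying $\omega\big((\mathcal{J}-\mu\mathbb{1})\star_\hbar(\mathcal{J}-\mu\mathbb{1})\big)=0$ (the quadratic module of the reduction at $\mu$). *)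

theory Defs
  imports Complex_Main "HOL-Library.Function_Algebras" "HOL-Library.Complex_Order"
begin

text \<open>Multi-indices K in N_0^(1+n) are functions nat => nat vanishing beyond n.
A complex polynomial on C^(1+n) in z and conj z is represented by its coefficient
function f K L = coefficient of z^K conj(z)^L (finitely many nonzero).
Holomorphic polynomials (Fock space elements) are coefficient functions psi K.\<close>

type_synonym mindex = "nat \<Rightarrow> nat"
type_synonym cpoly = "mindex \<Rightarrow> mindex \<Rightarrow> complex"
type_synonym hpoly = "mindex \<Rightarrow> complex"

definition mi_on :: "nat \<Rightarrow> mindex \<Rightarrow> bool" where
  "mi_on n K \<longleftrightarrow> (\<forall>i>n. K i = 0)"

definition mdeg :: "nat \<Rightarrow> mindex \<Rightarrow> nat" where
  "mdeg n K = (\<Sum>i\<le>n. K i)"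

definition mfact :: "nat \<Rightarrow> mindex \<Rightarrow> real" where
  "mfact n K = (\<Prod>i\<le>n. fact (K i))"

definition msub :: "mindex \<Rightarrow> mindex \<Rightarrow> mindex" where
  "msub K M = (\<lambda>i. K i - M i)"

definition psupp :: "cpoly \<Rightarrow> (mindex \<times> mindex) set" where
  "psupp f = {(K, L). f K L \<noteq> 0}"

definition polys :: "nat \<Rightarrow> cpoly set" where
  "polys n = {f. finite (psupp f) \<and> (\<forall>K L. f K L \<noteq> 0 \<longrightarrow> mi_on n K \<and> mi_on n L)}"

text \<open>Pointwise complex conjugation: conj(z^K conj(z)^L) = z^L conj(z)^K.\<close>
definition padj :: "cpoly \<Rightarrow> cpoly" where
  "padj f = (\<lambda>K L. cnj (f L K))"

definition psmult :: "complex \<Rightarrow> cpoly \<Rightarrow> cpoly" where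
  "psmult c f = (\<lambda>K L. c * f K L)"

text \<open>Wick star product, written out on monomials:
 dbar^M (z^K zbar^L) = L!/(L-M)! z^K zbar^(L-M),  d^M (z^K' zbar^L') = K'!/(K'-M)! z^(K'-M) zbar^L'.\<close>
definition wick :: "nat \<Rightarrow> real \<Rightarrow> cpoly \<Rightarrow> cpoly \<Rightarrow> cpoly" where
  "wick n h f g = (\<lambda>A B.
     \<Sum>(K, L)\<in>psupp f. \<Sum>(K', L')\<in>psupp g. \<Sum>M\<in>{M. \<forall>i. M i \<le> L i \<and> M i \<le> K' i}.
       (if (\<forall>i. A i = K i + K' i - M i \<and> B i = L i + L' i - M i)
        then complex_of_real (h ^ mdeg n M / mfact n M * (mfact n L / mfact n (msub L M))
                 * (mfact n K' / mfact n (msub K' M))) * f K L * g K' L'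
        else 0))"

definition pone :: cpoly where
  "pone = (\<lambda>K L. if K = (\<lambda>_. 0) \<and> L = (\<lambda>_. 0) then 1 else 0)"

definition unitmi :: "nat \<Rightarrow> mindex" where
  "unitmi j = (\<lambda>i. if i = j then 1 else 0)"

definition Jpoly :: "nat \<Rightarrow> cpoly" where
  "Jpoly n = (\<lambda>K L. if \<exists>j\<le>n. K = unitmi j \<and> L = unitmi j then 1 else 0)"

definition Balg :: "nat \<Rightarrow> cpoly set" where
  "Balg n = {f \<in> polys n. \<forall>K L. f K L \<noteq> 0 \<longrightarrow> mdeg n K = mdeg n L}"

definition fock :: "nat \<Rightarrow> hpoly set" where
  "fock n = {\<psi>. finite {K. \<psi> K \<noteq> 0} \<and> (\<forall>K. \<psi> K \<noteq> 0 \<longrightarrow> mi_on n K)}"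

definition finner :: "nat \<Rightarrow> real \<Rightarrow> hpoly \<Rightarrow> hpoly \<Rightarrow> complex" where
  "finner n h \<phi> \<psi> = (\<Sum>K\<in>{K. \<phi> K \<noteq> 0 \<or> \<psi> K \<noteq> 0}.
      cnj (\<phi> K) * \<psi> K * complex_of_real (h ^ mdeg n K * mfact n K))"

text \<open>pi_h(z^K conj(z)^L) = z^K h^|L| d^L.\<close>
definition frep :: "nat \<Rightarrow> real \<Rightarrow> cpoly \<Rightarrow> hpoly \<Rightarrow> hpoly" where
  "frep n h f \<psi> = (\<lambda>A. \<Sum>(K, L)\<in>psupp f. \<Sum>B\<in>{B. \<psi> B \<noteq> 0}.
      (if (\<forall>i. L i \<le> B i \<and> A i = K i + B i - L i)
       then complex_of_real (h ^ mdeg n L * (mfact n B / mfact n (msub B L))) * f K L * \<psi> B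
       else 0))"

definition Bpos :: "nat \<Rightarrow> real \<Rightarrow> cpoly set" where
  "Bpos n h = {f \<in> Balg n. padj f = f \<and> (\<forall>g\<in>fock n. 0 \<le> finner n h g (frep n h f g))}"

definition is_state :: "nat \<Rightarrow> real \<Rightarrow> (cpoly \<Rightarrow> complex) \<Rightarrow> bool" where
  "is_state n h \<omega> \<longleftrightarrow>
     (\<forall>f\<in>Balg n. \<forall>g\<in>Balg n. \<omega> (f + g) = \<omega> f + \<omega> g) \<and>
     (\<forall>c. \<forall>f\<in>Balg n. \<omega> (psmult c f) = c * \<omega> f) \<and>
     \<omega> pone = 1 \<and>
     (\<forall>f\<in>Balg n. padj f = f \<longrightarrow> \<omega> f \<in> \<real>) \<and>
     (\<forall>f\<in>Bpos n h. 0 \<le> \<omega> f)"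

definition Jmu :: "nat \<Rightarrow> real \<Rightarrow> cpoly" where
  "Jmu n \<mu> = Jpoly n - psmult (complex_of_real \<mu>) pone"

definition Rred :: "nat \<Rightarrow> real \<Rightarrow> real \<Rightarrow> cpoly set" where
  "Rred n h \<mu> = {f \<in> Balg n. padj f = f \<and>
      (\<forall>\<omega>. is_state n h \<omega> \<and> \<omega> (wick n h (Jmu n \<mu>) (Jmu n \<mu>)) = 0 \<longrightarrow> 0 \<le> \<omega> f)}"

definition sos :: "nat \<Rightarrow> real \<Rightarrow> cpoly set" where
  "sos n h = {(\<Sum>j<l. wick n h (padj (a j)) (a j)) | (l::nat) a. \<forall>j<l. a j \<in> Balg n}"

definition star_ideal :: "nat \<Rightarrow> real \<Rightarrow> cpoly \<Rightarrow> cpoly set" where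
  "star_ideal n h x = \<Inter>{I. I \<subseteq> Balg n \<and> x \<in> I \<and> 0 \<in> I \<and>
      (\<forall>f\<in>I. \<forall>g\<in>I. f + g \<in> I) \<and> (\<forall>c. \<forall>f\<in>I. psmult c f \<in> I) \<and>
      (\<forall>a\<in>Balg n. \<forall>f\<in>I. wick n h a f \<in> I \<and> wick n h f a \<in> I) \<and>
      (\<forall>f\<in>I. padj f \<in> I)}"

end

theory Submission
  imports Defs "HOL-Library.FuncSet"
begin

text \<open>The ideal of $J - \mu$ consists of the multiples of $J - \mu$, which is central, and is killed by all
admissible states by Cauchy--Schwarz. For the hard inclusion let $g$ have bidegree difference $r$.
Inserting $\sum_j \bar z_j \star z_j = J + \hbar(n+1)$ repeatedly between $g$ and $\bar g$ shows that
$g \star \bar g$ times a rising factorial of $J$ is a sum of squares in $B$; modulo the ideal this factorial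
is a positive number as long as $\mu + \hbar(n+1-r) > 0$. So $z^K \bar z^K$ with $|K| = r$ lies in the cone
$C$ = (sums of squares) + (Hermitian part of the ideal), although it is not obviously a square. On the other hand
$\sum_{|K|=r} (r!/K!)\, z^K \bar z^K$ is congruent to $\mu(\mu-\hbar)\cdots(\mu-(r-1)\hbar)$.

If $\mu/\hbar$ is not a natural number, take $r = \lfloor\mu/\hbar\rfloor + 2$ (this needs $n \ge 1$): the
product is negative, so $-1 \in C$ and $C$ is everything. If $\mu = \hbar k$, take $r = k+1$: the product
vanishes, so all $z^K \bar z^L$ of degree $k+1$ lie in the complexified lineality space of $C$, which is an ideal and hence
contains all higher degrees. Lower degrees are raised to degree $k$ by multiplication with $J$, and an element
of degree $k$ that is nonnegative on the eigenspace has a positive semidefinite coefficient matrix, hence is a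
sum of elements $g \star \bar g$ with $g$ holomorphic of degree $k$.\<close>

section \<open>Monomials and linearity\<close>

text \<open>The obstacle is that z^K zbar^K is a square \<open>g \<star> padj g\<close> only in the
  full polynomial algebra: its two factors shift the degree by r and -r and lie outside B. Each
  inserted zbar_j lowers the shift by one until the factors do lie in B. The price is a factor J + h
  (n + 1 - r), in which n + 1 counts the commutators of the n + 1 modes and -r comes from moving J
  past g. This smallest factor is the positivity condition. For p = floor(mu/h) and r = p + 2 the
  condition reads (mu - h p) + h (n - 1) > 0; for r = k + 1 and mu = h k it reads h n > 0. This is
  where n >= 1 enters. For n = 0 the algebra consists of polynomials in J, its quotient by J - mu is
  C, and -1 stays outside the cone. For non-integral mu/h the cone is everything regardless of any
  state. In the integral case the states enter through vector states: the eigenspace of J consists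
  of the holomorphic polynomials of degree k, and positivity there is positivity of a finite matrix.
  Associativity of the star product is read off from a faithful representation, whose
  multiplicativity is a Vandermonde identity in each coordinate.\<close>

text \<open>Induction rules eta-expand polynomials. The pointwise simplification rules would then unfold
  sums of polynomials, so they are switched off.\<close>

lemmas fun_ops = plus_fun_apply zero_fun_apply minus_apply uminus_apply
declare fun_ops [simp del]

lemma sum_fun_apply: "(\<Sum>x\<in>S. f x) A = (\<Sum>x\<in>S. f x A)"
  for f :: "'a \<Rightarrow> 'b \<Rightarrow> 'c::comm_monoid_add"
  by (induction S rule: infinite_finite_induct) (auto simp: fun_ops)

definition zmono :: "mindex \<Rightarrow> mindex \<Rightarrow> cpoly" where
  "zmono K L = (\<lambda>A B. if A = K \<and> B = L then 1 else 0)"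

definition hbase :: "mindex \<Rightarrow> hpoly" where
  "hbase B = (\<lambda>A. if A = B then 1 else 0)"

definition hsmult :: "complex \<Rightarrow> hpoly \<Rightarrow> hpoly" where
  "hsmult c \<psi> = (\<lambda>A. c * \<psi> A)"

lemma psupp_mono [simp]: "psupp (zmono K L) = {(K, L)}"
  by (auto simp: psupp_def zmono_def)

lemma hsupp_hbase [simp]: "{A. hbase B A \<noteq> 0} = {B}"
  by (auto simp: hbase_def)

lemma psupp_add: "psupp (f + g) \<subseteq> psupp f \<union> psupp g"
  by (auto simp: psupp_def fun_ops)

lemma psupp_psmult: "psupp (psmult c f) \<subseteq> psupp f"
  by (auto simp: psupp_def psmult_def)

lemma polysD_finite: "f \<in> polys n \<Longrightarrow> finite (psupp f)"
  by (simp add: polys_def)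

lemma polys_0 [simp]: "0 \<in> polys n"
  by (auto simp: polys_def psupp_def fun_ops)

lemma polys_mono [simp]: "mi_on n K \<Longrightarrow> mi_on n L \<Longrightarrow> zmono K L \<in> polys n"
  by (simp add: polys_def) (simp add: zmono_def)

lemma polys_add [simp]: "f \<in> polys n \<Longrightarrow> g \<in> polys n \<Longrightarrow> f + g \<in> polys n"
  unfolding polys_def
  by (auto simp: fun_ops intro: finite_subset[OF psupp_add]) (metis add.right_neutral)+

lemma polys_psmult [simp]: "f \<in> polys n \<Longrightarrow> psmult c f \<in> polys n"
  unfolding polys_def
  by (auto intro: finite_subset[OF psupp_psmult]) (auto simp: psmult_def)

lemma psmult_minus_one: "psmult (-1) f = - f"
  by (simp add: psmult_def fun_eq_iff fun_ops)

lemma polys_uminus [simp]: "f \<in> polys n \<Longrightarrow> - f \<in> polys n"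
  using polys_psmult[of f n "-1"] by (simp add: psmult_minus_one)

lemma polys_diff [simp]: "f \<in> polys n \<Longrightarrow> g \<in> polys n \<Longrightarrow> f - g \<in> polys n"
  using polys_add[of f n "- g"] by simp

lemma polys_sum [simp]: "\<forall>x\<in>S. f x \<in> polys n \<Longrightarrow> sum f S \<in> polys n"
  by (induction S rule: infinite_finite_induct) auto

lemma psupp_padj: "psupp (padj f) = prod.swap ` psupp f"
  by (force simp: psupp_def padj_def)

lemma polys_padj [simp]: "f \<in> polys n \<Longrightarrow> padj f \<in> polys n"
  unfolding polys_def by (auto simp: psupp_padj) (auto simp: padj_def)

lemma psmult_simps [simp]:
  "psmult c (psmult d f) = psmult (c * d) f"
  "psmult 1 f = f" "psmult 0 f = 0" "psmult c 0 = 0"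
  "psmult c (- f) = psmult (- c) f"
  by (auto simp: psmult_def fun_eq_iff fun_ops)

lemma psmult_add_right: "psmult c (f + g) = psmult c f + psmult c g"
  by (auto simp: psmult_def fun_eq_iff fun_ops algebra_simps)

lemma psmult_add_left: "psmult (c + d) f = psmult c f + psmult d f"
  by (auto simp: psmult_def fun_eq_iff fun_ops algebra_simps)

lemma psmult_diff_right: "psmult c (f - g) = psmult c f - psmult c g"
  by (auto simp: psmult_def fun_eq_iff fun_ops algebra_simps)

lemma psmult_diff_left: "psmult (c - d) f = psmult c f - psmult d f"
  by (auto simp: psmult_def fun_eq_iff fun_ops algebra_simps)

lemma psmult_uminus_left: "psmult (- c) f = - psmult c f"
  by (auto simp: psmult_def fun_eq_iff fun_ops algebra_simps)

lemma psmult_sum_right: "psmult c (\<Sum>x\<in>S. f x) = (\<Sum>x\<in>S. psmult c (f x))"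
  by (induction S rule: infinite_finite_induct) (auto simp: psmult_add_right)

lemma padj_simps [simp]:
  "padj (padj f) = f" "padj 0 = 0"
  "padj (f + g) = padj f + padj g" "padj (f - g) = padj f - padj g"
  "padj (- f) = - padj f" "padj (psmult c f) = psmult (cnj c) (padj f)"
  "padj (zmono K L) = zmono L K"
  by (auto simp: padj_def psmult_def zmono_def fun_eq_iff fun_ops)

lemma padj_sum: "padj (\<Sum>x\<in>S. f x) = (\<Sum>x\<in>S. padj (f x))"
  by (induction S rule: infinite_finite_induct) auto

lemma cpoly_expand:
  assumes "finite S" "psupp f \<subseteq> S"
  shows "f = (\<Sum>(K, L)\<in>S. psmult (f K L) (zmono K L))"
proof (intro ext)
  fix A B
  have "(\<Sum>(K, L)\<in>S. psmult (f K L) (zmono K L)) A B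
      = (\<Sum>p\<in>S. if p = (A, B) then f A B else 0)"
    unfolding sum_fun_apply by (rule sum.cong) (auto simp: psmult_def zmono_def split: if_splits)
  also have "\<dots> = f A B"
    using assms by (auto simp: psupp_def)
  finally show "f A B = (\<Sum>(K, L)\<in>S. psmult (f K L) (zmono K L)) A B" ..
qed

text \<open>The monomial case is asked only for monomials in the support of \<open>f\<close>, so
  whatever is known about the support (grading, homogeneity, a fixed conjugate degree) is available
  there. The induction rules for \<open>polys\<close>, \<open>graded\<close> and
  \<open>homog\<close> come from this form.\<close>

lemma finite_psupp_induct:
  assumes "f \<in> polys n" and "\<And>K L. f K L \<noteq> 0 \<Longrightarrow> P (zmono K L)" and "P 0"
    and "\<And>f g. f \<in> polys n \<Longrightarrow> g \<in> polys n \<Longrightarrow> P f \<Longrightarrow> P g \<Longrightarrow> P (f + g)"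
    and "\<And>c f. f \<in> polys n \<Longrightarrow> P f \<Longrightarrow> P (psmult c f)"
  shows "P f"
proof -
  have *: "(\<Sum>(K, L)\<in>S. psmult (f K L) (zmono K L)) \<in> polys n \<and> P (\<Sum>(K, L)\<in>S. psmult (f K L) (zmono K L))"
    if "finite S" "S \<subseteq> psupp f" for S
    using that
  proof (induction S)
    case empty
    then show ?case using assms by simp
  next
    case (insert x S)
    obtain K L where x: "x = (K, L)" by force
    have nz: "f K L \<noteq> 0" using insert x by (auto simp: psupp_def)
    then have "zmono K L \<in> polys n" using assms(1) by (intro polys_mono) (auto simp: polys_def)
    then show ?case using insert nz assms(2,4,5) by (simp add: x)
  qed
  show ?thesis
    using *[of "psupp f"] assms(1) cpoly_expand[of "psupp f" f] by (simp add: polysD_finite)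
qed

lemma polys_induct [consumes 1, case_names zmono zero add psmult]:
  assumes "f \<in> polys n" and "\<And>K L. mi_on n K \<Longrightarrow> mi_on n L \<Longrightarrow> P (zmono K L)" and "P 0"
    and "\<And>f g. f \<in> polys n \<Longrightarrow> g \<in> polys n \<Longrightarrow> P f \<Longrightarrow> P g \<Longrightarrow> P (f + g)"
    and "\<And>c f. f \<in> polys n \<Longrightarrow> P f \<Longrightarrow> P (psmult c f)"
  shows "P f"
  using assms(1)
  by (rule finite_psupp_induct) (use assms in \<open>(simp; fail | simp add: polys_def; fail)+\<close>)

section \<open>Fock space vectors as combinations of monomials\<close>

lemma fock_0 [simp]: "0 \<in> fock n"
  by (simp add: fock_def fun_ops)

lemma fock_hbase [simp]: "mi_on n B \<Longrightarrow> hbase B \<in> fock n"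
  unfolding fock_def by (auto simp: hbase_def)

lemma fock_add [simp]: "\<phi> \<in> fock n \<Longrightarrow> \<psi> \<in> fock n \<Longrightarrow> \<phi> + \<psi> \<in> fock n"
  unfolding fock_def
  by (auto simp: fun_ops intro: finite_subset[of _ "{K. \<phi> K \<noteq> 0} \<union> {K. \<psi> K \<noteq> 0}"]) (metis add.right_neutral)

lemma fock_hsmult [simp]: "\<psi> \<in> fock n \<Longrightarrow> hsmult c \<psi> \<in> fock n"
  unfolding fock_def hsmult_def by (auto intro: finite_subset[of _ "{K. \<psi> K \<noteq> 0}"])

lemma fock_sum [simp]: "\<forall>x\<in>S. f x \<in> fock n \<Longrightarrow> sum f S \<in> fock n"
  by (induction S rule: infinite_finite_induct) auto

lemma hsmult_simps [simp]:
  "hsmult c (hsmult d \<psi>) = hsmult (c * d) \<psi>" "hsmult 1 \<psi> = \<psi>" "hsmult 0 \<psi> = 0" "hsmult c 0 = 0"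
  by (auto simp: hsmult_def fun_eq_iff fun_ops)

lemma hsmult_add: "hsmult c (\<phi> + \<psi>) = hsmult c \<phi> + hsmult c \<psi>"
  by (auto simp: hsmult_def fun_eq_iff fun_ops algebra_simps)

lemma hpoly_expand:
  assumes "finite S" "{K. \<psi> K \<noteq> 0} \<subseteq> S"
  shows "\<psi> = (\<Sum>B\<in>S. hsmult (\<psi> B) (hbase B))"
proof
  fix A
  have "(\<Sum>B\<in>S. hsmult (\<psi> B) (hbase B)) A = (\<Sum>B\<in>S. if B = A then \<psi> A else 0)"
    unfolding sum_fun_apply by (rule sum.cong) (auto simp: hsmult_def hbase_def)
  also have "\<dots> = \<psi> A" using assms by auto
  finally show "\<psi> A = (\<Sum>B\<in>S. hsmult (\<psi> B) (hbase B)) A" ..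
qed

lemma fock_induct [consumes 1, case_names hbase zero add hsmult]:
  assumes "\<psi> \<in> fock n" and "\<And>B. mi_on n B \<Longrightarrow> P (hbase B)" and "P 0"
    and "\<And>\<phi> \<psi>. \<phi> \<in> fock n \<Longrightarrow> \<psi> \<in> fock n \<Longrightarrow> P \<phi> \<Longrightarrow> P \<psi> \<Longrightarrow> P (\<phi> + \<psi>)"
    and "\<And>c \<psi>. \<psi> \<in> fock n \<Longrightarrow> P \<psi> \<Longrightarrow> P (hsmult c \<psi>)"
  shows "P \<psi>"
proof -
  have *: "(\<Sum>B\<in>S. hsmult (\<psi> B) (hbase B)) \<in> fock n \<and> P (\<Sum>B\<in>S. hsmult (\<psi> B) (hbase B))"
    if "finite S" "S \<subseteq> {K. \<psi> K \<noteq> 0}" for S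
    using that
  proof (induction S)
    case empty
    then show ?case using assms by simp
  next
    case (insert x S)
    then have "mi_on n x" using assms(1) by (auto simp: fock_def)
    then show ?case using insert assms(2,4,5) by simp
  qed
  show ?thesis
    using *[of "{K. \<psi> K \<noteq> 0}"] assms(1) hpoly_expand[of "{K. \<psi> K \<noteq> 0}" \<psi>] by (simp add: fock_def)
qed

section \<open>The Wick product: bilinearity, monomials, adjoints\<close>

locale wick_algebra =
  fixes n :: nat and h :: real
  assumes h_pos: "h > 0"
begin

abbreviation star :: "cpoly \<Rightarrow> cpoly \<Rightarrow> cpoly" (infixl "\<star>" 70) where
  "f \<star> g \<equiv> wick n h f g"

text \<open>Apart from h^|M|, the number of ways to pair off, for each i, M_i of the L_i conjugate
  variables with M_i of the K'_i holomorphic ones.\<close>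

definition contr :: "mindex \<Rightarrow> mindex \<Rightarrow> mindex \<Rightarrow> real" where
  "contr L K' M = h ^ mdeg n M / mfact n M * (mfact n L / mfact n (msub L M))
                 * (mfact n K' / mfact n (msub K' M))"

definition wcoeff :: "mindex \<Rightarrow> mindex \<Rightarrow> mindex \<Rightarrow> mindex \<Rightarrow> cpoly" where
  "wcoeff K L K' L' = (\<lambda>A B. \<Sum>M\<in>{M. \<forall>i. M i \<le> L i \<and> M i \<le> K' i}.
      if \<forall>i. A i = K i + K' i - M i \<and> B i = L i + L' i - M i
      then complex_of_real (contr L K' M) else 0)"

text \<open>\<open>wick\<close> sums over supports, which change under addition and scaling.
  Arbitrary finite supersets put all terms of a linearity law over one index set, where the law
  holds term by term.\<close>

lemma wick_expand:
  assumes "finite S" "psupp f \<subseteq> S" "finite T" "psupp g \<subseteq> T"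
  shows "(f \<star> g) A B = (\<Sum>(K, L)\<in>S. \<Sum>(K', L')\<in>T. wcoeff K L K' L' A B * f K L * g K' L')"
proof -
  have "(f \<star> g) A B = (\<Sum>(K, L)\<in>psupp f. \<Sum>(K', L')\<in>psupp g. wcoeff K L K' L' A B * f K L * g K' L')"
    unfolding wick_def wcoeff_def contr_def
    by (intro sum.cong refl) (auto simp: sum_distrib_right intro!: sum.cong)
  also have "\<dots> = (\<Sum>(K, L)\<in>psupp f. \<Sum>(K', L')\<in>T. wcoeff K L K' L' A B * f K L * g K' L')"
    using assms by (intro sum.cong refl) (auto simp: psupp_def intro!: sum.mono_neutral_left)
  also have "\<dots> = (\<Sum>(K, L)\<in>S. \<Sum>(K', L')\<in>T. wcoeff K L K' L' A B * f K L * g K' L')"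
    using assms by (intro sum.mono_neutral_left) (auto simp: psupp_def)
  finally show ?thesis .
qed

lemma wick_add_left [simp]:
  assumes "f \<in> polys n" "f' \<in> polys n" "g \<in> polys n"
  shows "(f + f') \<star> g = f \<star> g + f' \<star> g"
proof (intro ext)
  fix A B
  let ?S = "psupp f \<union> psupp f'"
  have "finite ?S" "finite (psupp g)" using assms by (auto simp: polysD_finite)
  then show "((f + f') \<star> g) A B = (f \<star> g + f' \<star> g) A B"
    using psupp_add[of f f']
    by (simp add: wick_expand[of ?S _ "psupp g"] case_prod_beta sum.distrib[symmetric] fun_ops algebra_simps)
qed

lemma wick_add_right [simp]:
  assumes "f \<in> polys n" "g \<in> polys n" "g' \<in> polys n"
  shows "f \<star> (g + g') = f \<star> g + f \<star> g'"
proof (intro ext)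
  fix A B
  let ?S = "psupp g \<union> psupp g'"
  have "finite ?S" "finite (psupp f)" using assms by (auto simp: polysD_finite)
  then show "(f \<star> (g + g')) A B = (f \<star> g + f \<star> g') A B"
    using psupp_add[of g g']
    by (simp add: wick_expand[of "psupp f" _ ?S] case_prod_beta sum.distrib[symmetric] fun_ops algebra_simps)
qed

lemma wick_psmult_left [simp]:
  assumes "f \<in> polys n" "g \<in> polys n"
  shows "psmult c f \<star> g = psmult c (f \<star> g)"
proof (intro ext)
  fix A B
  have "finite (psupp g)" "finite (psupp f)" using assms by (auto simp: polysD_finite)
  then show "(psmult c f \<star> g) A B = psmult c (f \<star> g) A B"
    using psupp_psmult[of c f]
    by (simp add: wick_expand[of "psupp f" _ "psupp g"] psmult_def sum_distrib_left algebra_simps case_prod_beta)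
qed

lemma wick_psmult_right [simp]:
  assumes "f \<in> polys n" "g \<in> polys n"
  shows "f \<star> psmult c g = psmult c (f \<star> g)"
proof (intro ext)
  fix A B
  have "finite (psupp g)" "finite (psupp f)" using assms by (auto simp: polysD_finite)
  then show "(f \<star> psmult c g) A B = psmult c (f \<star> g) A B"
    using psupp_psmult[of c g]
    by (simp add: wick_expand[of "psupp f" _ "psupp g"] psmult_def sum_distrib_left algebra_simps case_prod_beta)
qed

lemma wick_0 [simp]: "0 \<star> g = 0" "f \<star> 0 = 0"
  by (auto simp: wick_def psupp_def fun_eq_iff fun_ops case_prod_beta)

lemma wick_uminus [simp]:
  assumes "f \<in> polys n" "g \<in> polys n"
  shows "(- f) \<star> g = - (f \<star> g)" "f \<star> (- g) = - (f \<star> g)"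
  using wick_psmult_left[OF assms, of "-1"] wick_psmult_right[OF assms, of "-1"]
  by (simp_all add: psmult_minus_one)

lemma wick_diff_left [simp]:
  "f \<in> polys n \<Longrightarrow> f' \<in> polys n \<Longrightarrow> g \<in> polys n \<Longrightarrow> (f - f') \<star> g = f \<star> g - f' \<star> g"
  using wick_add_left[of f "- f'" g] by simp

lemma wick_diff_right [simp]:
  "f \<in> polys n \<Longrightarrow> g \<in> polys n \<Longrightarrow> g' \<in> polys n \<Longrightarrow> f \<star> (g - g') = f \<star> g - f \<star> g'"
  using wick_add_right[of f g "- g'"] by simp

lemma wick_sum_left:
  "\<forall>x\<in>S. f x \<in> polys n \<Longrightarrow> g \<in> polys n \<Longrightarrow> (\<Sum>x\<in>S. f x) \<star> g = (\<Sum>x\<in>S. f x \<star> g)"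
  by (induction S rule: infinite_finite_induct) auto

lemma wick_sum_right:
  "\<forall>x\<in>S. f x \<in> polys n \<Longrightarrow> g \<in> polys n \<Longrightarrow> g \<star> (\<Sum>x\<in>S. f x) = (\<Sum>x\<in>S. g \<star> f x)"
  by (induction S rule: infinite_finite_induct) auto

lemma wick_mono:
  "zmono K L \<star> zmono K' L' = (\<Sum>M\<in>{M. \<forall>i. M i \<le> L i \<and> M i \<le> K' i}.
     psmult (contr L K' M) (zmono (\<lambda>i. K i + K' i - M i) (\<lambda>i. L i + L' i - M i)))"
proof (intro ext)
  fix A B
  have 1: "(zmono K L \<star> zmono K' L') A B = wcoeff K L K' L' A B"
    by (subst wick_expand[of "{(K, L)}" _ "{(K', L')}"]) (simp_all, simp add: zmono_def)
  show "(zmono K L \<star> zmono K' L') A B = (\<Sum>M\<in>{M. \<forall>i. M i \<le> L i \<and> M i \<le> K' i}.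
     psmult (contr L K' M) (zmono (\<lambda>i. K i + K' i - M i) (\<lambda>i. L i + L' i - M i))) A B"
    unfolding 1 wcoeff_def sum_fun_apply by (intro sum.cong refl) (auto simp: psmult_def zmono_def fun_eq_iff)
qed

lemma polys_wick [simp]:
  assumes "f \<in> polys n" "g \<in> polys n" shows "f \<star> g \<in> polys n"
  using assms(1)
proof (induction f rule: polys_induct)
  case (zmono K L)
  note KL = this
  show ?case using assms(2)
  proof (induction g rule: polys_induct)
    case (zmono K' L')
    then show ?case using KL unfolding wick_mono
      by (intro polys_sum ballI polys_psmult polys_mono) (auto simp: mi_on_def)
  qed (use KL in auto)
qed (use assms in auto)

lemma contr_swap: "contr L K' M = contr K' L M"
  by (simp add: contr_def mult_ac)

lemma padj_wick [simp]:
  assumes "f \<in> polys n" "g \<in> polys n" shows "padj (f \<star> g) = padj g \<star> padj f"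
  using assms(1)
proof (induction f rule: polys_induct)
  case (zmono K L)
  note KL = this
  show ?case using assms(2)
  proof (induction g rule: polys_induct)
    case (zmono K' L')
    have "{M. \<forall>i. M i \<le> L i \<and> M i \<le> K' i} = {M. \<forall>i. M i \<le> K' i \<and> M i \<le> L i}" by auto
    then show ?case by (simp add: wick_mono padj_sum contr_swap add.commute)
  qed (use KL in auto)
qed (use assms in auto)

section \<open>The Fock representation on monomials\<close>

definition fcoeff :: "mindex \<Rightarrow> mindex \<Rightarrow> mindex \<Rightarrow> hpoly" where
  "fcoeff K L B = (\<lambda>A. if \<forall>i. L i \<le> B i \<and> A i = K i + B i - L i
       then complex_of_real (h ^ mdeg n L * (mfact n B / mfact n (msub B L))) else 0)"

lemma frep_expand:
  assumes "finite S" "psupp f \<subseteq> S" "finite T" "{B. \<psi> B \<noteq> 0} \<subseteq> T"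
  shows "frep n h f \<psi> A = (\<Sum>(K, L)\<in>S. \<Sum>B\<in>T. fcoeff K L B A * f K L * \<psi> B)"
proof -
  have "frep n h f \<psi> A = (\<Sum>(K, L)\<in>psupp f. \<Sum>B\<in>{B. \<psi> B \<noteq> 0}. fcoeff K L B A * f K L * \<psi> B)"
    unfolding frep_def fcoeff_def
    by (intro sum.cong refl) (auto simp: sum_distrib_right intro!: sum.cong)
  also have "\<dots> = (\<Sum>(K, L)\<in>psupp f. \<Sum>B\<in>T. fcoeff K L B A * f K L * \<psi> B)"
    using assms by (intro sum.cong refl) (auto simp: psupp_def intro!: sum.mono_neutral_left)
  also have "\<dots> = (\<Sum>(K, L)\<in>S. \<Sum>B\<in>T. fcoeff K L B A * f K L * \<psi> B)"
    using assms by (intro sum.mono_neutral_left) (auto simp: psupp_def)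
  finally show ?thesis .
qed

lemma fockD_finite: "\<psi> \<in> fock n \<Longrightarrow> finite {B. \<psi> B \<noteq> 0}"
  by (simp add: fock_def)

lemma frep_add_left [simp]:
  assumes "f \<in> polys n" "f' \<in> polys n" "\<psi> \<in> fock n"
  shows "frep n h (f + f') \<psi> = frep n h f \<psi> + frep n h f' \<psi>"
proof
  fix A
  let ?S = "psupp f \<union> psupp f'"
  have "finite ?S" "finite {B. \<psi> B \<noteq> 0}" using assms by (auto simp: polysD_finite fockD_finite)
  then show "frep n h (f + f') \<psi> A = (frep n h f \<psi> + frep n h f' \<psi>) A"
    using psupp_add[of f f']
    by (simp add: frep_expand[of ?S _ "{B. \<psi> B \<noteq> 0}"] case_prod_beta sum.distrib[symmetric] fun_ops algebra_simps)
qed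

lemma frep_psmult_left [simp]:
  assumes "f \<in> polys n" "\<psi> \<in> fock n"
  shows "frep n h (psmult c f) \<psi> = hsmult c (frep n h f \<psi>)"
proof
  fix A
  have "finite (psupp f)" "finite {B. \<psi> B \<noteq> 0}" using assms by (auto simp: polysD_finite fockD_finite)
  then show "frep n h (psmult c f) \<psi> A = hsmult c (frep n h f \<psi>) A"
    using psupp_psmult[of c f]
    by (simp add: frep_expand[of "psupp f" _ "{B. \<psi> B \<noteq> 0}"] psmult_def hsmult_def sum_distrib_left
        algebra_simps case_prod_beta)
qed

lemma frep_add_right [simp]:
  assumes "f \<in> polys n" "\<phi> \<in> fock n" "\<psi> \<in> fock n"
  shows "frep n h f (\<phi> + \<psi>) = frep n h f \<phi> + frep n h f \<psi>"
proof
  fix A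
  let ?S = "{B. \<phi> B \<noteq> 0} \<union> {B. \<psi> B \<noteq> 0}"
  have *: "finite ?S" "finite (psupp f)" using assms by (auto simp: polysD_finite fockD_finite)
  have **: "{B. (\<phi> + \<psi>) B \<noteq> 0} \<subseteq> ?S" by (auto simp: fun_ops)
  show "frep n h f (\<phi> + \<psi>) A = (frep n h f \<phi> + frep n h f \<psi>) A"
    using *
    by (simp add: frep_expand[OF _ _ _ **, of "psupp f"] frep_expand[of "psupp f" _ ?S] case_prod_beta sum.distrib[symmetric] fun_ops algebra_simps)
qed

lemma frep_hsmult_right [simp]:
  assumes "f \<in> polys n" "\<psi> \<in> fock n"
  shows "frep n h f (hsmult c \<psi>) = hsmult c (frep n h f \<psi>)"
proof
  fix A
  have *: "finite (psupp f)" "finite {B. \<psi> B \<noteq> 0}" using assms by (auto simp: polysD_finite fockD_finite)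
  have **: "{B. hsmult c \<psi> B \<noteq> 0} \<subseteq> {B. \<psi> B \<noteq> 0}" by (auto simp: hsmult_def)
  show "frep n h f (hsmult c \<psi>) A = hsmult c (frep n h f \<psi>) A"
    using * frep_expand[OF *(1) order.refl *(2) **, of A]
    by (simp add: frep_expand[of "psupp f" _ "{B. \<psi> B \<noteq> 0}"] hsmult_def sum_distrib_left
        algebra_simps case_prod_beta)
qed

lemma frep_0 [simp]: "frep n h 0 \<psi> = 0" "frep n h f 0 = 0"
  by (auto simp: frep_def psupp_def fun_eq_iff fun_ops case_prod_beta)

lemma frep_uminus_left [simp]: "f \<in> polys n \<Longrightarrow> \<psi> \<in> fock n \<Longrightarrow> frep n h (- f) \<psi> = - frep n h f \<psi>"
  using frep_psmult_left[of f \<psi> "-1"] by (simp add: psmult_minus_one hsmult_def fun_eq_iff fun_ops)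

lemma frep_diff_left [simp]:
  "f \<in> polys n \<Longrightarrow> g \<in> polys n \<Longrightarrow> \<psi> \<in> fock n \<Longrightarrow> frep n h (f - g) \<psi> = frep n h f \<psi> - frep n h g \<psi>"
  using frep_add_left[of f "- g" \<psi>] by simp

lemma frep_sum_left:
  "\<forall>x\<in>S. f x \<in> polys n \<Longrightarrow> \<psi> \<in> fock n \<Longrightarrow> frep n h (\<Sum>x\<in>S. f x) \<psi> = (\<Sum>x\<in>S. frep n h (f x) \<psi>)"
  by (induction S rule: infinite_finite_induct) auto

text \<open>The factor h^|L| B!/(B-L)! of \<open>frep\<close>, written with binomials so that it
  vanishes by itself when some L_i > B_i. Truncated subtraction in exponents is then harmless:
  wherever it cuts something off, the coefficient is 0.\<close>

definition ffact :: "mindex \<Rightarrow> mindex \<Rightarrow> real" where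
  "ffact L B = (\<Prod>i\<le>n. h ^ L i * fact (L i) * real (B i choose L i))"

lemma h_pow_mdeg: "h ^ mdeg n M = (\<Prod>i\<le>n. h ^ M i)"
  by (simp add: mdeg_def power_sum)

lemma ffact_eq_0: "mi_on n L \<Longrightarrow> \<not> (\<forall>i. L i \<le> B i) \<Longrightarrow> ffact L B = 0"
proof -
  assume *: "mi_on n L" "\<not> (\<forall>i. L i \<le> B i)"
  then obtain i where i: "B i < L i" by (auto simp: not_le)
  then have "i \<le> n" using * by (metis mi_on_def not_less_zero not_le)
  then show ?thesis unfolding ffact_def using i by (auto intro!: bexI[of _ i] simp: binomial_eq_0)
qed

lemma frep_mono:
  assumes "mi_on n L"
  shows "frep n h (zmono K L) (hbase B) = hsmult (ffact L B) (hbase (\<lambda>i. K i + B i - L i))"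
proof
  fix A
  have 1: "frep n h (zmono K L) (hbase B) A = fcoeff K L B A"
    by (subst frep_expand[of "{(K, L)}" _ "{B}"]) (simp_all, simp add: zmono_def hbase_def)
  show "frep n h (zmono K L) (hbase B) A = hsmult (ffact L B) (hbase (\<lambda>i. K i + B i - L i)) A"
  proof (cases "\<forall>i. L i \<le> B i")
    case True
    then have "ffact L B = h ^ mdeg n L * (mfact n B / mfact n (msub B L))"
      unfolding ffact_def h_pow_mdeg mfact_def msub_def
      by (simp add: binomial_fact prod_dividef prod.distrib[symmetric])
    then show ?thesis using True unfolding 1 by (simp add: fcoeff_def hsmult_def hbase_def fun_eq_iff)
  next
    case False
    then have "\<not> (\<forall>i. L i \<le> B i \<and> A i = K i + B i - L i)" by blast
    then show ?thesis unfolding 1 by (simp only: fcoeff_def hsmult_def ffact_eq_0[OF assms False] if_False of_real_0 mult_zero_left)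
  qed
qed

lemma fock_frep [simp]:
  assumes "f \<in> polys n" "\<psi> \<in> fock n" shows "frep n h f \<psi> \<in> fock n"
  using assms(1)
proof (induction f rule: polys_induct)
  case (zmono K L)
  note KL = this
  show ?case using assms(2)
  proof (induction rule: fock_induct)
    case (hbase B)
    then show ?case using KL unfolding frep_mono[OF KL(2)]
      by (intro fock_hsmult fock_hbase) (auto simp: mi_on_def)
  qed (use KL in auto)
qed (use assms in auto)

section \<open>Multiplicativity of the Fock representation\<close>

lemma contr_prod:
  "contr L K' M = (\<Prod>i\<le>n. h ^ M i / fact (M i) * (fact (L i) / fact (L i - M i)) * (fact (K' i) / fact (K' i - M i)))"
  unfolding contr_def h_pow_mdeg mfact_def msub_def by (simp add: prod.distrib prod_dividef)

text \<open>One coordinate of \<open>frep_wick\<close>: the coefficient of (h d)^l z^k (h d)^l' on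
  z^b, expanded by the Leibniz rule on the left and computed directly on the right. Once the factors
  free of m are pulled out, the sum is Vandermonde's convolution.\<close>

lemma vandermonde_falling:
  fixes l k l' b :: nat
  shows "(\<Sum>m\<in>{m. m \<le> l \<and> m \<le> k}. h ^ m / fact m * (fact l / fact (l - m)) * (fact k / fact (k - m))
           * (h ^ (l + l' - m) * fact (l + l' - m) * real (b choose (l + l' - m))))
       = h ^ l' * fact l' * real (b choose l') * (h ^ l * fact l * real ((k + b - l') choose l))"
proof (cases "l' \<le> b")
  case False
  then show ?thesis by (auto intro!: sum.neutral simp: binomial_eq_0)
next
  case True
  have "(\<Sum>m\<in>{m. m \<le> l \<and> m \<le> k}. h ^ m / fact m * (fact l / fact (l - m)) * (fact k / fact (k - m))
           * (h ^ (l + l' - m) * fact (l + l' - m) * real (b choose (l + l' - m))))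
      = (\<Sum>m\<in>{m. m \<le> l \<and> m \<le> k}. h ^ l' * fact l' * real (b choose l') * (h ^ l * fact l) * real ((k choose m) * ((b - l') choose (l - m))))"
  proof (intro sum.cong refl)
    fix m assume "m \<in> {m. m \<le> l \<and> m \<le> k}"
    then have m: "m \<le> l" "m \<le> k" by auto
    have hh: "h ^ m * h ^ (l + l' - m) = h ^ l * h ^ l'" using m by (simp add: power_add[symmetric])
    have kk: "fact k / (fact m * fact (k - m)) = (real (k choose m) :: real)" using m by (simp add: binomial_fact)
    \<comment> \<open>A falling factorial of b of length l' + (l - m) splits into one of b of length
      l' and one of b - l' of length l - m.\<close>
    have bb: "fact (l + l' - m) * real (b choose (l + l' - m)) / fact (l - m)
        = fact l' * real (b choose l') * real ((b - l') choose (l - m))"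
    proof (cases "l - m \<le> b - l'")
      case False
      then have "\<not> l + l' - m \<le> b" using True m by linarith
      with False show ?thesis by (simp add: binomial_eq_0)
    next
      case t: True
      then have t': "l + l' - m \<le> b" using True m by linarith
      have e: "b - (l + l' - m) = b - l' - (l - m)" using m t' True by linarith
      show ?thesis
        unfolding binomial_fact[OF t] binomial_fact[OF t'] binomial_fact[OF True] e
        by (simp add: field_simps)
    qed
    have "h ^ m / fact m * (fact l / fact (l - m)) * (fact k / fact (k - m))
           * (h ^ (l + l' - m) * fact (l + l' - m) * real (b choose (l + l' - m)))
       = (h ^ m * h ^ (l + l' - m)) * fact l * (fact k / (fact m * fact (k - m))) *
           (fact (l + l' - m) * real (b choose (l + l' - m)) / fact (l - m))"
      by (simp add: field_simps)
    also have "\<dots> = h ^ l' * fact l' * real (b choose l') * (h ^ l * fact l) * real ((k choose m) * ((b - l') choose (l - m)))"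
      unfolding hh kk bb by simp
    finally show "h ^ m / fact m * (fact l / fact (l - m)) * (fact k / fact (k - m))
           * (h ^ (l + l' - m) * fact (l + l' - m) * real (b choose (l + l' - m)))
       = h ^ l' * fact l' * real (b choose l') * (h ^ l * fact l) * real ((k choose m) * ((b - l') choose (l - m)))" .
  qed
  also have "\<dots> = h ^ l' * fact l' * real (b choose l') * (h ^ l * fact l) *
      real (\<Sum>m\<in>{m. m \<le> l \<and> m \<le> k}. (k choose m) * ((b - l') choose (l - m)))"
    by (simp add: sum_distrib_left)
  also have "(\<Sum>m\<in>{m. m \<le> l \<and> m \<le> k}. (k choose m) * ((b - l') choose (l - m)))
      = (\<Sum>m\<le>l. (k choose m) * ((b - l') choose (l - m)))"
    by (rule sum.mono_neutral_left) (auto simp: binomial_eq_0)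
  also have "\<dots> = (k + (b - l')) choose l" by (simp add: vandermonde)
  finally show ?thesis using True by simp
qed

text \<open>\<open>prod_sum_PiE\<close> yields functions that are undefined outside {..n}, whereas
  multi-indices are 0 there; the condition S i = {0} beyond n makes the two index sets
  correspond.\<close>

lemma prod_sum_mindex:
  fixes F :: "nat \<Rightarrow> nat \<Rightarrow> real"
  assumes "\<And>i. finite (S i)" "\<And>i. i > n \<Longrightarrow> S i = {0}"
  shows "(\<Prod>i\<le>n. \<Sum>m\<in>S i. F i m) = (\<Sum>M\<in>{M. \<forall>i. M i \<in> S i}. \<Prod>i\<le>n. F i (M i))"
proof -
  have "(\<Prod>i\<le>n. \<Sum>m\<in>S i. F i m) = (\<Sum>M\<in>PiE {..n} S. \<Prod>i\<le>n. F i (M i))"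
    using assms by (simp add: prod_sum_PiE)
also have "\<dots> = (\<Sum>M\<in>{M. \<forall>i. M i \<in> S i}. \<Prod>i\<le>n. F i (M i))"
  proof (rule sum.reindex_bij_witness[where i = "\<lambda>M. restrict M {..n}" and j = "\<lambda>M i. if i \<le> n then M i else 0"])
    fix M assume M: "M \<in> {M. \<forall>i. M i \<in> S i}"
    then have "M i = 0" if "i > n" for i using assms(2)[OF that] by (metis mem_Collect_eq singletonD)
    then show "(\<lambda>i. if i \<le> n then restrict M {..n} i else 0) = M" by (auto simp: fun_eq_iff)
    show "restrict M {..n} \<in> PiE {..n} S" using M by auto
  next
    fix M assume M: "M \<in> PiE {..n} S"
    then show "restrict (\<lambda>i. if i \<le> n then M i else 0) {..n} = M"
      by (auto simp: fun_eq_iff restrict_def PiE_def extensional_def)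
    have "(if i \<le> n then M i else 0) \<in> S i" for i
      using M assms(2)[of i] by (cases "i \<le> n") auto
    then show "(\<lambda>i. if i \<le> n then M i else 0) \<in> {M. \<forall>i. M i \<in> S i}" by blast
    show "(\<Prod>i\<le>n. F i (if i \<le> n then M i else 0)) = (\<Prod>i\<le>n. F i (M i))" by simp
  qed
  finally show ?thesis .
qed

lemma ffact_vandermonde:
  assumes "mi_on n L" "mi_on n K'"
  shows "(\<Sum>M\<in>{M. \<forall>i. M i \<le> L i \<and> M i \<le> K' i}. contr L K' M * ffact (\<lambda>i. L i + L' i - M i) B)
     = ffact L' B * ffact L (\<lambda>i. K' i + B i - L' i)"
proof -
  have "(\<Sum>M\<in>{M. \<forall>i. M i \<le> L i \<and> M i \<le> K' i}. contr L K' M * ffact (\<lambda>i. L i + L' i - M i) B)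
    = (\<Sum>M\<in>{M. \<forall>i. M i \<in> {m. m \<le> L i \<and> m \<le> K' i}}. \<Prod>i\<le>n.
       h ^ M i / fact (M i) * (fact (L i) / fact (L i - M i)) * (fact (K' i) / fact (K' i - M i))
         * (h ^ (L i + L' i - M i) * fact (L i + L' i - M i) * real (B i choose (L i + L' i - M i))))"
    by (simp only: contr_prod ffact_def prod.distrib mem_Collect_eq)
  also have "\<dots> = (\<Prod>i\<le>n. \<Sum>m\<in>{m. m \<le> L i \<and> m \<le> K' i}.
       h ^ m / fact m * (fact (L i) / fact (L i - m)) * (fact (K' i) / fact (K' i - m))
         * (h ^ (L i + L' i - m) * fact (L i + L' i - m) * real (B i choose (L i + L' i - m))))"
    by (rule prod_sum_mindex[symmetric]) (use assms in \<open>auto simp: mi_on_def\<close>)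
  also have "\<dots> = ffact L' B * ffact L (\<lambda>i. K' i + B i - L' i)"
    unfolding vandermonde_falling ffact_def prod.distrib[symmetric] ..
  finally show ?thesis .
qed

text \<open>Trilinearity leaves two monomials acting on z^B; there the contraction sum factors over
  the coordinates into instances of \<open>vandermonde_falling\<close>.\<close>

lemma frep_wick [simp]:
  assumes "f \<in> polys n" "g \<in> polys n" "\<psi> \<in> fock n"
  shows "frep n h (f \<star> g) \<psi> = frep n h f (frep n h g \<psi>)"
  using assms(1)
proof (induction f rule: polys_induct)
  case (zmono K L)
  note KL = this
  show ?case using assms(2)
  proof (induction g rule: polys_induct)
    case (zmono K' L')
    note KL' = this
    show ?case using assms(3)
    proof (induction rule: fock_induct)
      case (hbase B)
      let ?MS = "{M. \<forall>i. M i \<le> L i \<and> M i \<le> K' i}"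
      \<comment> \<open>Both sides are multiples of this monomial. Truncated subtraction can make an
        exponent differ from \<open>?X\<close> only when the accompanying \<open>ffact\<close> is
        0.\<close>
      let ?X = "\<lambda>i. K i + K' i + B i - L i - L' i"
      have mi: "mi_on n (\<lambda>i. L i + L' i - M i)" "mi_on n (\<lambda>i. K i + K' i - M i)" for M
        using KL KL' by (auto simp: mi_on_def)
      have "frep n h (zmono K L \<star> zmono K' L') (hbase B)
         = (\<Sum>M\<in>?MS. hsmult (complex_of_real (contr L K' M)) (frep n h (zmono (\<lambda>i. K i + K' i - M i) (\<lambda>i. L i + L' i - M i)) (hbase B)))"
        using mi hbase by (simp add: wick_mono frep_sum_left)
      also have "\<dots> = (\<Sum>M\<in>?MS. hsmult (complex_of_real (contr L K' M * ffact (\<lambda>i. L i + L' i - M i) B)) (hbase ?X))"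
      proof (intro sum.cong refl)
        fix M assume M: "M \<in> ?MS"
        have "hbase (\<lambda>i. K i + K' i - M i + B i - (L i + L' i - M i)) = hbase ?X"
          if "\<forall>i. L i + L' i - M i \<le> B i"
        proof (intro arg_cong[where f = hbase] ext)
          fix i
          show "K i + K' i - M i + B i - (L i + L' i - M i) = K i + K' i + B i - L i - L' i"
            using spec[OF that, of i] M by (auto dest!: spec[of _ i])
        qed
        then show "hsmult (contr L K' M) (frep n h (zmono (\<lambda>i. K i + K' i - M i) (\<lambda>i. L i + L' i - M i)) (hbase B))
          = hsmult (contr L K' M * ffact (\<lambda>i. L i + L' i - M i) B) (hbase ?X)"
          using ffact_eq_0[OF mi(1), of M B]
          by (cases "\<forall>i. L i + L' i - M i \<le> B i") (simp_all add: frep_mono[OF mi(1)] del: diff_diff_left)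
      qed
      also have "\<dots> = hsmult (complex_of_real (\<Sum>M\<in>?MS. contr L K' M * ffact (\<lambda>i. L i + L' i - M i) B)) (hbase ?X)"
        by (auto simp: fun_eq_iff fun_ops hsmult_def sum_fun_apply sum_distrib_right)
      also have "\<dots> = hsmult (ffact L' B * ffact L (\<lambda>i. K' i + B i - L' i)) (hbase ?X)"
        by (simp add: ffact_vandermonde KL KL')
      also have "\<dots> = hsmult (ffact L' B * ffact L (\<lambda>i. K' i + B i - L' i)) (hbase (\<lambda>i. K i + (K' i + B i - L' i) - L i))"
      proof (cases "(\<forall>i. L' i \<le> B i) \<and> (\<forall>i. L i \<le> K' i + B i - L' i)")
        case True
        then have "?X = (\<lambda>i. K i + (K' i + B i - L' i) - L i)"
          by (intro ext) (metis Nat.add_diff_assoc add.assoc diff_commute trans_le_add2)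
        then show ?thesis by simp
      next
        case False
        then have "ffact L' B = 0 \<or> ffact L (\<lambda>i. K' i + B i - L' i) = 0"
          using ffact_eq_0[OF KL(2), of "\<lambda>i. K' i + B i - L' i"] ffact_eq_0[OF KL'(2), of B] by blast
        then show ?thesis by (elim disjE) simp_all
      qed
      also have "\<dots> = frep n h (zmono K L) (frep n h (zmono K' L') (hbase B))"
      proof -
        have "mi_on n (\<lambda>i. K' i + B i - L' i)" using KL' hbase by (auto simp: mi_on_def)
        then show ?thesis using KL KL' by (simp add: frep_mono)
      qed
      finally show ?case .
    qed (use KL KL' in auto)
  qed (use KL assms in auto)
qed (use assms in auto)

end

section \<open>The Fock representation and associativity\<close>

definition graded :: "nat \<Rightarrow> int \<Rightarrow> cpoly \<Rightarrow> bool" where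
  "graded n r f \<longleftrightarrow> f \<in> polys n \<and> (\<forall>K L. f K L \<noteq> 0 \<longrightarrow> int (mdeg n K) = int (mdeg n L) + r)"

lemma gradedD: "graded n r f \<Longrightarrow> f \<in> polys n"
  by (simp add: graded_def)

lemma Balg_graded: "Balg n = {f. graded n 0 f}"
  by (simp add: Balg_def graded_def Collect_conj_eq[symmetric] set_eq_iff)

lemma graded_0 [simp]: "graded n r 0"
  by (simp add: graded_def fun_ops)

lemma graded_add [simp]: "graded n r f \<Longrightarrow> graded n r g \<Longrightarrow> graded n r (f + g)"
  unfolding graded_def by (auto simp: fun_ops) (metis add.right_neutral)

lemma graded_psmult [simp]: "graded n r f \<Longrightarrow> graded n r (psmult c f)"
  by (simp add: graded_def) (simp add: psmult_def)

lemma graded_zmono [simp]: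
  "mi_on n K \<Longrightarrow> mi_on n L \<Longrightarrow> int (mdeg n K) = int (mdeg n L) + r \<Longrightarrow> graded n r (zmono K L)"
  by (simp add: graded_def) (simp add: zmono_def)

lemma graded_padj [simp]: "graded n r f \<Longrightarrow> graded n (- r) (padj f)"
  unfolding graded_def by (simp, simp add: padj_def)

lemma graded_sum [simp]: "\<forall>x\<in>S. graded n r (f x) \<Longrightarrow> graded n r (sum f S)"
  by (induction S rule: infinite_finite_induct) auto

lemma graded_induct [consumes 1, case_names zmono zero add psmult]:
  assumes "graded n r f"
    and "\<And>K L. mi_on n K \<Longrightarrow> mi_on n L \<Longrightarrow> int (mdeg n K) = int (mdeg n L) + r \<Longrightarrow> P (zmono K L)"
    and "P 0"
    and "\<And>f g. f \<in> polys n \<Longrightarrow> g \<in> polys n \<Longrightarrow> P f \<Longrightarrow> P g \<Longrightarrow> P (f + g)"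
    and "\<And>c f. f \<in> polys n \<Longrightarrow> P f \<Longrightarrow> P (psmult c f)"
  shows "P f"
  using gradedD[OF assms(1)]
proof (rule finite_psupp_induct)
  fix K L assume "f K L \<noteq> 0"
  then show "P (zmono K L)" using assms(1,2) by (simp add: graded_def polys_def)
qed (use assms in auto)

lemma mdeg_add [simp]: "mdeg n (\<lambda>i. K i + L i) = mdeg n K + mdeg n L"
  by (simp add: mdeg_def sum.distrib)

lemma mdeg_zero [simp]: "mdeg n (\<lambda>_. 0) = 0"
  by (simp add: mdeg_def)

lemma mindex_le_antisym:
  assumes "mi_on n K" "mi_on n L" "\<forall>i. K i \<le> L i" "mdeg n L \<le> mdeg n K"
  shows "K = L"
proof
  fix i
  show "K i = L i"
  proof (cases "i \<le> n")
    case True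
    show ?thesis
    proof (rule ccontr)
      assume "K i \<noteq> L i"
      with assms(3) have "K i < L i" by (simp add: le_neq_implies_less)
      then have "mdeg n K < mdeg n L" unfolding mdeg_def
        using assms(3) True by (intro sum_strict_mono_ex1) auto
      with assms(4) show False by simp
    qed
  qed (use assms(1,2) in \<open>simp add: mi_on_def\<close>)
qed

lemma mi_on_zero [simp]: "mi_on n (\<lambda>_. 0)"
  by (simp add: mi_on_def)

lemma mi_on_add [simp]: "mi_on n K \<Longrightarrow> mi_on n L \<Longrightarrow> mi_on n (\<lambda>i. K i + L i)"
  by (simp add: mi_on_def)

lemma mi_on_unitmi [simp]: "j \<le> n \<Longrightarrow> mi_on n (unitmi j)"
  by (simp add: mi_on_def unitmi_def)

lemma mdeg_unitmi [simp]: "j \<le> n \<Longrightarrow> mdeg n (unitmi j) = 1"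
  by (simp add: mdeg_def unitmi_def)

lemma pone_zmono: "pone = zmono (\<lambda>_. 0) (\<lambda>_. 0)"
  by (simp add: pone_def zmono_def)

lemma polys_pone [simp]: "pone \<in> polys n"
  by (simp add: pone_zmono)

lemma padj_pone [simp]: "padj pone = pone"
  by (simp add: pone_zmono)

lemma Jpoly_zmono: "Jpoly n = (\<Sum>j\<le>n. zmono (unitmi j) (unitmi j))"
proof (intro ext)
  fix A B
  have inj: "unitmi i = unitmi j \<longleftrightarrow> i = j" for i j
    by (auto simp: unitmi_def fun_eq_iff)
  show "Jpoly n A B = (\<Sum>j\<le>n. zmono (unitmi j) (unitmi j)) A B"
  proof (cases "\<exists>j\<le>n. A = unitmi j \<and> B = unitmi j")
    case True
    then obtain j where j: "j \<le> n" "A = unitmi j" "B = unitmi j" by blast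
    then have "(\<Sum>i\<le>n. zmono (unitmi i) (unitmi i)) A B = (\<Sum>i\<le>n. if i = j then 1 else 0)"
      unfolding sum_fun_apply by (intro sum.cong) (auto simp: zmono_def inj)
    then show ?thesis using j by (auto simp: Jpoly_def)
  next
    case False
    then have "(\<Sum>i\<le>n. zmono (unitmi i) (unitmi i)) A B = 0"
      unfolding sum_fun_apply by (intro sum.neutral) (auto simp: zmono_def)
    then show ?thesis using False by (simp add: Jpoly_def)
  qed
qed

lemma polys_Jpoly [simp]: "Jpoly n \<in> polys n"
  by (simp add: Jpoly_zmono)

lemma padj_Jpoly [simp]: "padj (Jpoly n) = Jpoly n"
  by (simp add: Jpoly_zmono padj_sum)

lemma Balg_polys [simp]: "f \<in> Balg n \<Longrightarrow> f \<in> polys n"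
  by (simp add: Balg_def)

lemma Balg_closed [simp]:
  "0 \<in> Balg n" "pone \<in> Balg n" "Jpoly n \<in> Balg n"
  "f \<in> Balg n \<Longrightarrow> g \<in> Balg n \<Longrightarrow> f + g \<in> Balg n"
  "f \<in> Balg n \<Longrightarrow> psmult c f \<in> Balg n"
  "f \<in> Balg n \<Longrightarrow> padj f \<in> Balg n"
  using graded_padj[of n 0 f] by (auto simp: Balg_graded pone_zmono Jpoly_zmono)

lemma Balg_uminus [simp]: "f \<in> Balg n \<Longrightarrow> - f \<in> Balg n"
  using Balg_closed(5)[of f n "-1"] by (simp add: psmult_minus_one)

lemma Balg_diff [simp]: "f \<in> Balg n \<Longrightarrow> g \<in> Balg n \<Longrightarrow> f - g \<in> Balg n"
  using Balg_closed(4)[of f n "- g"] by simp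

lemma Balg_sum [simp]: "\<forall>x\<in>S. f x \<in> Balg n \<Longrightarrow> sum f S \<in> Balg n"
  by (induction S rule: infinite_finite_induct) auto

lemma Balg_zmono [simp]:
  "mi_on n K \<Longrightarrow> mi_on n L \<Longrightarrow> mdeg n K = mdeg n L \<Longrightarrow> zmono K L \<in> Balg n"
  by (simp add: Balg_graded)

lemma Jmu_Balg [simp]: "Jmu n \<mu> \<in> Balg n"
  by (simp add: Jmu_def)

lemma padj_Jmu [simp]: "padj (Jmu n \<mu>) = Jmu n \<mu>"
  by (simp add: Jmu_def)

text \<open>Multiplication by the function J with respect to the pointwise product.\<close>

definition Jmul :: "nat \<Rightarrow> cpoly \<Rightarrow> cpoly" where
  "Jmul n f = (\<lambda>A B. \<Sum>j\<le>n. if A j > 0 \<and> B j > 0 then f (msub A (unitmi j)) (msub B (unitmi j)) else 0)"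

lemma Jmul_linear [simp]:
  "Jmul n 0 = 0" "Jmul n (f + g) = Jmul n f + Jmul n g" "Jmul n (psmult c f) = psmult c (Jmul n f)"
  by (auto simp: Jmul_def fun_eq_iff fun_ops psmult_def sum_distrib_left sum.distrib[symmetric] intro!: sum.cong sum.neutral)

lemma Jmul_zmono: "Jmul n (zmono K L) = (\<Sum>j\<le>n. zmono (\<lambda>i. K i + unitmi j i) (\<lambda>i. L i + unitmi j i))"
proof (intro ext)
  fix A B
  have *: "A j > 0 \<and> msub A (unitmi j) = K \<longleftrightarrow> A = (\<lambda>i. K i + unitmi j i)" for A K j
  proof
    assume A: "A j > 0 \<and> msub A (unitmi j) = K"
    show "A = (\<lambda>i. K i + unitmi j i)"
    proof
      fix i
      have "K i = A i - unitmi j i" using A by (auto simp: msub_def)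
      then show "A i = K i + unitmi j i" using A by (auto simp: unitmi_def)
    qed
  qed (auto simp: msub_def unitmi_def)
  show "Jmul n (zmono K L) A B = (\<Sum>j\<le>n. zmono (\<lambda>i. K i + unitmi j i) (\<lambda>i. L i + unitmi j i)) A B"
    unfolding sum_fun_apply Jmul_def zmono_def *[symmetric] by (intro sum.cong) auto
qed

section \<open>Faithfulness, associativity, and commutation with J\<close>

context wick_algebra
begin

text \<open>Test on z^L, where (K, L) is in the support with |L| minimal. A term (K', L') survives
  only if L' \<le> L, and minimality then gives L' = L. So the coefficient of z^K in the image is
  h^|L| L! times \<open>f K L\<close>.\<close>

lemma frep_inj:
  assumes f: "f \<in> polys n" and 0: "\<And>B. mi_on n B \<Longrightarrow> frep n h f (hbase B) = 0"
  shows "f = 0"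
proof (rule ccontr)
  assume "f \<noteq> 0"
  then obtain K\<^sub>0 L\<^sub>0 where "f K\<^sub>0 L\<^sub>0 \<noteq> 0" by (auto simp: fun_eq_iff fun_ops)
  then obtain K L where KL: "f K L \<noteq> 0" and min: "\<And>K' L'. f K' L' \<noteq> 0 \<Longrightarrow> mdeg n L \<le> mdeg n L'"
    using ex_has_least_nat[of "\<lambda>L. \<exists>K. f K L \<noteq> 0" L\<^sub>0 "mdeg n"] by blast
  have mi: "mi_on n K" "mi_on n L" using f KL by (auto simp: polys_def)
  have "frep n h f (hbase L) K = (\<Sum>(K', L')\<in>psupp f. fcoeff K' L' L K * f K' L')"
    by (subst frep_expand[of "psupp f" _ "{L}"]) (use f in \<open>simp_all add: polysD_finite\<close>, simp add: hbase_def)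
  also have "\<dots> = (\<Sum>p\<in>psupp f. if p = (K, L) then complex_of_real (h ^ mdeg n L * mfact n L) * f K L else 0)"
  proof (intro sum.cong refl)
    fix p assume "p \<in> psupp f"
    then obtain K' L' where p: "p = (K', L')" "f K' L' \<noteq> 0" by (auto simp: psupp_def)
    show "(case p of (K', L') \<Rightarrow> fcoeff K' L' L K * f K' L') = (if p = (K, L) then complex_of_real (h ^ mdeg n L * mfact n L) * f K L else 0)"
    proof (cases "\<forall>i. L' i \<le> L i \<and> K i = K' i + L i - L' i")
      case True
      have L': "mi_on n L'" using f p by (auto simp: polys_def)
      have "L' = L" using True min[OF p(2)] mi L' by (intro mindex_le_antisym) auto
      moreover from this have "K' = K" using True by (auto simp: fun_eq_iff)
      ultimately show ?thesis by (simp add: p fcoeff_def msub_def mfact_def)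
    next
      case False
      then have "(K', L') \<noteq> (K, L)" by auto
      have "fcoeff K' L' L K = 0" unfolding fcoeff_def using False by (rule if_not_P)
      then show ?thesis using \<open>(K', L') \<noteq> (K, L)\<close> unfolding p
        by (simp only: prod.case if_False mult_zero_left)
    qed
  qed
  also have "\<dots> = complex_of_real (h ^ mdeg n L * mfact n L) * f K L"
  proof -
    have "(K, L) \<in> psupp f" using KL by (simp add: psupp_def)
    then show ?thesis by (simp only: sum.delta[OF polysD_finite[OF f]] if_True)
  qed
  also have "\<dots> \<noteq> 0" using KL h_pos by (simp add: mfact_def)
  finally show False using 0[OF mi(2)] by (simp add: fun_ops)
qed

lemma frep_eqI:
  assumes "f \<in> polys n" "g \<in> polys n" "\<And>B. mi_on n B \<Longrightarrow> frep n h f (hbase B) = frep n h g (hbase B)"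
  shows "f = g"
  using frep_inj[of "f - g"] assms by simp

text \<open>Inherited from composition of operators, as the representation is multiplicative and
  faithful; this replaces an identity between double contraction sums.\<close>

lemma wick_assoc [simp]:
  "f \<in> polys n \<Longrightarrow> g \<in> polys n \<Longrightarrow> k \<in> polys n \<Longrightarrow> f \<star> g \<star> k = f \<star> (g \<star> k)"
  by (rule frep_eqI) simp_all

lemma frep_pone_hbase: "frep n h pone (hbase B) = hbase B"
  by (simp add: pone_zmono frep_mono ffact_def)

lemma frep_pone [simp]: "\<psi> \<in> fock n \<Longrightarrow> frep n h pone \<psi> = \<psi>"
  by (induction rule: fock_induct) (simp_all add: frep_pone_hbase)

lemma wick_pone [simp]: "f \<in> polys n \<Longrightarrow> pone \<star> f = f" "f \<in> polys n \<Longrightarrow> f \<star> pone = f"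
  by (rule frep_eqI; simp)+

lemma contr_zero [simp]: "contr L K' (\<lambda>_. 0) = 1"
proof -
  have "mfact n K \<noteq> 0" for K by (simp add: mfact_def)
  then show ?thesis by (simp add: contr_def msub_def) (simp add: mfact_def)
qed

lemma wick_zmono_left: "zmono K (\<lambda>_. 0) \<star> zmono K' L' = zmono (\<lambda>i. K i + K' i) L'"
proof -
  have "{M. \<forall>i. M i \<le> 0 \<and> M i \<le> K' i} = {\<lambda>_. 0}" by (auto simp: fun_eq_iff)
  then show ?thesis by (simp add: wick_mono)
qed

lemma wick_zmono_right: "zmono K L \<star> zmono (\<lambda>_. 0) L' = zmono K (\<lambda>i. L i + L' i)"
proof -
  have "{M. \<forall>i. M i \<le> L i \<and> M i \<le> 0} = {\<lambda>_. 0}" by (auto simp: fun_eq_iff)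
  then show ?thesis by (simp add: wick_mono)
qed

lemma graded_wick:
  assumes "graded n r f" "graded n s g" shows "graded n (r + s) (f \<star> g)"
  using assms(1)
proof (induction f rule: graded_induct)
  case (zmono K L)
  note KL = this
  show ?case using assms(2)
  proof (induction g rule: graded_induct)
    case (zmono K' L')
    have "graded n (r + s) (zmono (\<lambda>i. K i + K' i - M i) (\<lambda>i. L i + L' i - M i))"
      if M: "\<forall>i. M i \<le> L i \<and> M i \<le> K' i" for M
    proof (rule graded_zmono)
      have 1: "mdeg n (\<lambda>i. K i + K' i - M i) + mdeg n M = mdeg n K + mdeg n K'"
        "mdeg n (\<lambda>i. L i + L' i - M i) + mdeg n M = mdeg n L + mdeg n L'"
        using M unfolding mdeg_add[symmetric]
        by (auto intro!: arg_cong[of _ _ "mdeg n"] simp: fun_eq_iff trans_le_add1 trans_le_add2)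
      show "int (mdeg n (\<lambda>i. K i + K' i - M i)) = int (mdeg n (\<lambda>i. L i + L' i - M i)) + (r + s)"
        using 1 KL zmono by linarith
    qed (use KL zmono in \<open>auto simp: mi_on_def\<close>)
    then show ?case by (simp add: wick_mono)
  qed (use KL in auto)
qed (use assms gradedD in auto)

lemma Balg_wick [simp]: "f \<in> Balg n \<Longrightarrow> g \<in> Balg n \<Longrightarrow> f \<star> g \<in> Balg n"
  using graded_wick[of 0 f 0 g] by (simp add: Balg_graded)

lemma ffact_unitmi: "j \<le> n \<Longrightarrow> ffact (unitmi j) B = h * B j"
proof -
  assume j: "j \<le> n"
  have "ffact (unitmi j) B = (\<Prod>i\<le>n. if i = j then h * B j else 1)"
    unfolding ffact_def by (intro prod.cong) (auto simp: unitmi_def)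
  then show ?thesis using j by simp
qed

lemma frep_Jpoly_hbase: "mi_on n B \<Longrightarrow> frep n h (Jpoly n) (hbase B) = hsmult (h * mdeg n B) (hbase B)"
  by (simp add: Jpoly_zmono frep_sum_left frep_mono ffact_unitmi)
    (simp add: fun_eq_iff hsmult_def sum_fun_apply mdeg_def sum_distrib_left sum_distrib_right)

text \<open>J acts as h times the degree operator, and a monomial of bidegree difference r raises
  the degree by r unless it annihilates the vector. For r = 0 this makes J - mu central in B; for r
  > 0 it is the cost of moving J past g.\<close>

lemma Jpoly_graded_commute:
  assumes "graded n r f"
  shows "Jpoly n \<star> f = f \<star> Jpoly n + psmult (h * of_int r) f"
  using assms
proof (induction f rule: graded_induct)
  case (zmono K L)
  show ?case
  proof (rule frep_eqI)
    fix B assume B: "mi_on n B"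
    let ?X = "\<lambda>i. K i + B i - L i"
    have X: "mi_on n ?X" using zmono B by (simp add: mi_on_def)
    \<comment> \<open>If some L_i exceeds B_i, the monomial kills z^B and the degree of
      \<open>?X\<close> carries no information.\<close>
    have "ffact L B = 0 \<or> mdeg n ?X + mdeg n L = mdeg n K + mdeg n B"
    proof (cases "\<forall>i. L i \<le> B i")
      case True
      then show ?thesis unfolding mdeg_add[symmetric]
        by (auto intro!: arg_cong[of _ _ "mdeg n"] simp: fun_eq_iff trans_le_add2)
    qed (use ffact_eq_0[OF zmono(2)] in blast)
    then have "ffact L B = 0 \<or> int (mdeg n ?X) = int (mdeg n B) + r"
      using zmono(3) by linarith
    then have "ffact L B * real (mdeg n ?X) = ffact L B * (real (mdeg n B) + of_int r)"
    proof
      assume "int (mdeg n ?X) = int (mdeg n B) + r"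
      then have "real_of_int (int (mdeg n ?X)) = real_of_int (int (mdeg n B) + r)" by (simp only:)
      then show ?thesis by simp
    qed simp
    then have e: "complex_of_real (ffact L B) * of_nat (mdeg n ?X) = ffact L B * (of_nat (mdeg n B) + of_int r)"
      by (metis of_real_add of_real_mult of_real_of_nat_eq of_real_of_int_eq)
    have "frep n h (Jpoly n \<star> zmono K L) (hbase B) = hsmult (h * (ffact L B * of_nat (mdeg n ?X))) (hbase ?X)"
      using zmono B X by (simp add: frep_mono frep_Jpoly_hbase mult_ac)
    also have "\<dots> = frep n h (zmono K L \<star> Jpoly n + psmult (h * of_int r) (zmono K L)) (hbase B)"
      using zmono B X
      by (simp add: frep_mono frep_Jpoly_hbase)
        (simp add: fun_eq_iff hsmult_def fun_ops e distrib_left distrib_right mult_ac)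
    finally show "frep n h (Jpoly n \<star> zmono K L) (hbase B) =
      frep n h (zmono K L \<star> Jpoly n + psmult (h * of_int r) (zmono K L)) (hbase B)" .
  qed (use zmono in auto)
qed (auto simp: psmult_add_right mult_ac)

lemma Jmu_commute: "f \<in> Balg n \<Longrightarrow> f \<star> Jmu n \<mu> = Jmu n \<mu> \<star> f"
  using Jpoly_graded_commute[of 0 f] by (simp add: Balg_graded gradedD Jmu_def)

text \<open>No contraction occurs when z^K stands on the left or zbar^L on the right, so the
  pointwise product of J with z^K zbar^L is z^K \<star> (J \<star> zbar^L). Commuting J past zbar^L,
  which lowers the degree by m, costs -h m.\<close>

lemma Jmul_wick:
  assumes "f \<in> polys n" "\<And>K L. f K L \<noteq> 0 \<Longrightarrow> mdeg n L = m"
  shows "Jmul n f = f \<star> (Jpoly n - psmult (h * m) pone)"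
  using assms(1)
proof (rule finite_psupp_induct)
  fix K L assume "f K L \<noteq> 0"
  then have KL: "mi_on n K" "mi_on n L" "mdeg n L = m" using assms by (auto simp: polys_def)
  let ?O = "\<lambda>_. 0 :: nat"
  have "Jmul n (zmono K L) = zmono K ?O \<star> (Jpoly n \<star> zmono ?O L)"
    using KL by (simp add: Jmul_zmono Jpoly_zmono wick_sum_left wick_sum_right wick_zmono_right)
      (simp add: wick_zmono_left add.commute)
  also have "Jpoly n \<star> zmono ?O L = zmono ?O L \<star> Jpoly n + psmult (h * of_int (- int m)) (zmono ?O L)"
    using KL by (intro Jpoly_graded_commute) simp
  also have "zmono K ?O \<star> \<dots> = zmono K ?O \<star> zmono ?O L \<star> (Jpoly n - psmult (h * m) pone)"
    using KL by (simp add: psmult_uminus_left)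
  finally show "Jmul n (zmono K L) = zmono K L \<star> (Jpoly n - psmult (h * m) pone)"
    by (simp add: wick_zmono_right)
qed (auto simp: psmult_add_right psmult_diff_right mult_ac)

section \<open>The Fock inner product and adjoints\<close>

definition hwt :: "mindex \<Rightarrow> real" where
  "hwt K = (\<Prod>i\<le>n. h ^ K i * fact (K i))"

lemma hwt_pos: "hwt K > 0"
  using h_pos by (auto simp: hwt_def intro!: prod_pos)

lemma finner_expand:
  assumes "finite S" "{K. \<phi> K \<noteq> 0} \<subseteq> S" "{K. \<psi> K \<noteq> 0} \<subseteq> S"
  shows "finner n h \<phi> \<psi> = (\<Sum>K\<in>S. cnj (\<phi> K) * \<psi> K * hwt K)"
proof -
  have "h ^ mdeg n K * mfact n K = hwt K" for K
    by (simp add: hwt_def h_pow_mdeg mfact_def prod.distrib)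
  then have "finner n h \<phi> \<psi> = (\<Sum>K\<in>{K. \<phi> K \<noteq> 0 \<or> \<psi> K \<noteq> 0}. cnj (\<phi> K) * \<psi> K * hwt K)"
    unfolding finner_def by (simp del: of_real_mult)
  also have "\<dots> = (\<Sum>K\<in>S. cnj (\<phi> K) * \<psi> K * hwt K)"
    using assms by (intro sum.mono_neutral_left) auto
  finally show ?thesis .
qed

lemma finner_add_right [simp]:
  assumes "\<phi> \<in> fock n" "\<psi> \<in> fock n" "\<psi>' \<in> fock n"
  shows "finner n h \<phi> (\<psi> + \<psi>') = finner n h \<phi> \<psi> + finner n h \<phi> \<psi>'"
proof -
  let ?S = "{K. \<phi> K \<noteq> 0} \<union> {K. \<psi> K \<noteq> 0} \<union> {K. \<psi>' K \<noteq> 0}"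
  have "finite ?S" using assms by (simp add: fockD_finite)
  moreover have "{K. (\<psi> + \<psi>') K \<noteq> 0} \<subseteq> ?S" by (auto simp: fun_ops)
  ultimately show ?thesis
    by (subst (1 2 3) finner_expand[of ?S]) (auto simp: fun_ops sum.distrib[symmetric] algebra_simps)
qed

lemma finner_hsmult_right [simp]:
  assumes "\<phi> \<in> fock n" "\<psi> \<in> fock n"
  shows "finner n h \<phi> (hsmult c \<psi>) = c * finner n h \<phi> \<psi>"
proof -
  let ?S = "{K. \<phi> K \<noteq> 0} \<union> {K. \<psi> K \<noteq> 0}"
  have "finite ?S" using assms by (simp add: fockD_finite)
  moreover have "{K. hsmult c \<psi> K \<noteq> 0} \<subseteq> ?S" by (auto simp: hsmult_def)
  ultimately show ?thesis
    by (subst (1 2) finner_expand[of ?S]) (auto simp: hsmult_def sum_distrib_left algebra_simps)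
qed

lemma finner_commute: "finner n h \<phi> \<psi> = cnj (finner n h \<psi> \<phi>)"
proof -
  have "{K. \<phi> K \<noteq> 0 \<or> \<psi> K \<noteq> 0} = {K. \<psi> K \<noteq> 0 \<or> \<phi> K \<noteq> 0}" by auto
  then show ?thesis by (simp add: finner_def mult_ac)
qed

lemma finner_add_left [simp]:
  assumes "\<phi> \<in> fock n" "\<psi> \<in> fock n" "\<psi>' \<in> fock n"
  shows "finner n h (\<psi> + \<psi>') \<phi> = finner n h \<psi> \<phi> + finner n h \<psi>' \<phi>"
  using assms by (subst (1 2 3) finner_commute) simp

lemma finner_hsmult_left [simp]:
  assumes "\<phi> \<in> fock n" "\<psi> \<in> fock n"
  shows "finner n h (hsmult c \<psi>) \<phi> = cnj c * finner n h \<psi> \<phi>"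
  using assms by (subst (1 2) finner_commute) simp

lemma finner_0 [simp]: "finner n h 0 \<psi> = 0" "finner n h \<psi> 0 = 0"
  by (auto simp: finner_def fun_ops)

lemma finner_self_nonneg: "0 \<le> finner n h \<psi> \<psi>"
proof -
  have "finner n h \<psi> \<psi> = (\<Sum>K\<in>{K. \<psi> K \<noteq> 0}. of_real ((cmod (\<psi> K))\<^sup>2 * (h ^ mdeg n K * mfact n K)))"
    unfolding finner_def by (simp add: complex_norm_square mult.commute del: of_real_power) 
  also have "0 \<le> \<dots>"
    using h_pos by (intro sum_nonneg) (simp add: less_eq_complex_def mfact_def prod_nonneg del: of_real_mult of_real_power)
  finally show ?thesis .
qed

lemma finner_self_neq_0:
  assumes "\<psi> \<in> fock n" "\<psi> \<noteq> 0" shows "finner n h \<psi> \<psi> \<noteq> 0"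
proof -
  have fin: "finite {K. \<psi> K \<noteq> 0}" using assms fockD_finite by blast
  have "finner n h \<psi> \<psi> = of_real (\<Sum>K\<in>{K. \<psi> K \<noteq> 0}. (cmod (\<psi> K))\<^sup>2 * hwt K)"
    using fin by (simp add: finner_expand[of "{K. \<psi> K \<noteq> 0}"] complex_norm_square mult.commute del: of_real_power)
  moreover have "(\<Sum>K\<in>{K. \<psi> K \<noteq> 0}. (cmod (\<psi> K))\<^sup>2 * hwt K) > 0"
    using assms fin hwt_pos by (intro sum_pos) (auto simp: fun_eq_iff fun_ops)
  ultimately show ?thesis by (simp del: of_real_sum)
qed

lemma finner_hbase: "finner n h (hbase A) (hbase B) = (if A = B then of_real (hwt A) else 0)"
  by (subst finner_expand[of "{A, B}"]) (auto simp: hbase_def)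

text \<open>Adjointness of z_i and h d/dz_i on monomials: since A - K = B - L, both sides carry A!
  B! over the same denominator.\<close>

lemma ffact_hwt:
  assumes "\<And>i. L i \<le> B i" "\<And>i. A i = K i + B i - L i"
  shows "ffact L B * hwt A = ffact K A * hwt B"
proof -
  have "h ^ L i * fact (L i) * real (B i choose L i) * (h ^ A i * fact (A i))
     = h ^ K i * fact (K i) * real (A i choose K i) * (h ^ B i * fact (B i))" for i
  proof -
    have 1: "K i \<le> A i" "A i - K i = B i - L i" using assms[of i] by linarith+
    have 2: "h ^ L i * h ^ A i = h ^ K i * h ^ B i"
      using assms(1)[of i] by (simp add: power_add[symmetric] assms(2))
    have "fact (L i) * real (B i choose L i) = fact (B i) / fact (B i - L i)"
      "fact (K i) * real (A i choose K i) = fact (A i) / fact (A i - K i)"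
      using 1(1) assms(1)[of i] by (simp_all add: binomial_fact)
    then have "h ^ L i * h ^ A i * (fact (L i) * real (B i choose L i)) * fact (A i)
        = h ^ K i * h ^ B i * (fact (K i) * real (A i choose K i)) * fact (B i)"
      using 1(2) 2 by simp
    then show ?thesis by (simp only: mult_ac)
  qed
  then show ?thesis unfolding ffact_def hwt_def prod.distrib[symmetric] by (intro prod.cong) auto
qed

lemma finner_frep_adjoint:
  assumes "f \<in> polys n" "\<phi> \<in> fock n" "\<psi> \<in> fock n"
  shows "finner n h \<phi> (frep n h f \<psi>) = finner n h (frep n h (padj f) \<phi>) \<psi>"
  using assms(1)
proof (induction f rule: polys_induct)
  case (zmono K L)
  note KL = this
  show ?case using assms(3)
  proof (induction \<psi> rule: fock_induct)
    case (hbase B)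
    note B = this
    show ?case using assms(2)
    proof (induction \<phi> rule: fock_induct)
      case (hbase A)
      let ?X = "\<lambda>i. K i + B i - L i" and ?Y = "\<lambda>i. L i + A i - K i"
      have XY: "mi_on n ?X" "mi_on n ?Y" using KL B hbase by (auto simp: mi_on_def)
      have 1: "finner n h (hbase A) (frep n h (zmono K L) (hbase B)) = (if A = ?X then of_real (ffact L B * hwt A) else 0)"
        using KL B hbase XY by (simp add: frep_mono finner_hbase)
      have 2: "finner n h (frep n h (zmono L K) (hbase A)) (hbase B) = (if B = ?Y then of_real (ffact K A * hwt B) else 0)"
        using KL B hbase XY by (simp add: frep_mono finner_hbase eq_commute[of B])
      \<comment> \<open>\<open>A = ?X\<close> may also hold by accident of truncated subtraction,
        without L \<le> B. In the third case each such accident is met by a vanishing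
        \<open>ffact\<close>, so both sides are 0.\<close>
      consider "\<forall>i. L i \<le> B i" "A = ?X" | "\<forall>i. K i \<le> A i" "B = ?Y"
        | "\<not> ((\<forall>i. L i \<le> B i) \<and> A = ?X)" "\<not> ((\<forall>i. K i \<le> A i) \<and> B = ?Y)" by blast
      then show ?case
      proof cases
        case a: 1
        then have "B i = ?Y i" for i using fun_cong[OF a(2), of i] spec[OF a(1), of i] by linarith
        then have "B = ?Y" ..
        moreover have "ffact L B * hwt A = ffact K A * hwt B"
          by (rule ffact_hwt) (use a in auto)
        ultimately show ?thesis unfolding padj_simps 1 2 using a by simp
      next
        case a: 2
        then have "A i = ?X i" for i using fun_cong[OF a(2), of i] spec[OF a(1), of i] by linarith
        then have "A = ?X" ..
        moreover have "ffact K A * hwt B = ffact L B * hwt A"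
          by (rule ffact_hwt) (use a in auto)
        ultimately show ?thesis unfolding padj_simps 1 2 using a by simp
      next
        case 3
        then have "A = ?X \<Longrightarrow> ffact L B = 0" "B = ?Y \<Longrightarrow> ffact K A = 0"
          using ffact_eq_0 KL by blast+
        then have "(if A = ?X then complex_of_real (ffact L B * hwt A) else 0) = 0"
          "(if B = ?Y then complex_of_real (ffact K A * hwt B) else 0) = 0"
          by (metis mult_zero_left of_real_0)+
        then show ?thesis unfolding padj_simps 1 2 by (simp only:)
      qed
    qed (use KL B in auto)
  qed (use KL assms(2) in auto)
qed (use assms in auto)

end

section \<open>Sums of squares and the star ideal\<close>

text \<open>The order on \<open>complex\<close> forces the values to be real, so t = 0 and t = 1
  give Im s = 0; a real affine function bounded below on the whole line has slope 0.\<close>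

lemma affine_nonneg_imp_zero:
  fixes A s :: complex
  assumes "\<And>t::real. 0 \<le> A + of_real t * s"
  shows "s = 0"
proof -
  have *: "0 \<le> Re A + t * Re s" "Im A + t * Im s = 0" for t
    using assms[of t] by (auto simp: less_eq_complex_def)
  have "Im s = 0" using *(2)[of 0] *(2)[of 1] by simp
  moreover have "Re s = 0"
  proof (rule ccontr)
    assume "Re s \<noteq> 0"
    then show False using *(1)[of "- (Re A + 1) / Re s"] by simp
  qed
  ultimately show ?thesis by (simp add: complex_eq_iff)
qed

locale wick_reduction = wick_algebra +
  fixes \<mu> :: real
begin

lemma sos_induct [consumes 1, case_names zero add]:
  assumes "p \<in> sos n h" "P 0"
    "\<And>p a. p \<in> sos n h \<Longrightarrow> P p \<Longrightarrow> a \<in> Balg n \<Longrightarrow> P (p + padj a \<star> a)"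
  shows "P p"
proof -
  obtain l :: nat and a where p: "p = (\<Sum>j<l. padj (a j) \<star> a j)" "\<forall>j<l. a j \<in> Balg n"
    using assms(1) by (auto simp: sos_def)
  have "P (\<Sum>j<m. padj (a j) \<star> a j)" if "m \<le> l" for m
    using that
  proof (induction m)
    case (Suc m)
    then have "(\<Sum>j<m. padj (a j) \<star> a j) \<in> sos n h" using p(2) unfolding sos_def
      by (intro CollectI exI[of _ m] exI[of _ a]) simp
    then show ?case using Suc p(2) assms(3) by simp
  qed (use assms in simp)
  then show ?thesis using p(1) by simp
qed

lemma sos_zero [simp]: "0 \<in> sos n h"
  unfolding sos_def by (intro CollectI exI[of _ 0]) simp

lemma sos_add_square:
  assumes "p \<in> sos n h" "a \<in> Balg n" shows "p + padj a \<star> a \<in> sos n h"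
proof -
  obtain l :: nat and b where p: "p = (\<Sum>j<l. padj (b j) \<star> b j)" "\<forall>j<l. b j \<in> Balg n"
    using assms(1) by (auto simp: sos_def)
  have "p + padj a \<star> a = (\<Sum>j<Suc l. padj ((b(l := a)) j) \<star> (b(l := a)) j)"
    using p(1) by simp
  then show ?thesis unfolding sos_def using p(2) assms(2)
    by (intro CollectI exI[of _ "Suc l"] exI[of _ "b(l := a)"]) auto
qed

lemma sos_square: "a \<in> Balg n \<Longrightarrow> padj a \<star> a \<in> sos n h"
  using sos_add_square[of 0 a] by simp

lemma sos_Balg: "p \<in> sos n h \<Longrightarrow> p \<in> Balg n"
  by (induction rule: sos_induct) auto

lemma sos_hermitian: "p \<in> sos n h \<Longrightarrow> padj p = p"
  by (induction rule: sos_induct) auto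

lemma sos_add: "q \<in> sos n h \<Longrightarrow> p \<in> sos n h \<Longrightarrow> p + q \<in> sos n h"
  by (induction rule: sos_induct) (auto simp: add.assoc[symmetric] sos_add_square)

lemma sos_sum: "\<forall>x\<in>S. f x \<in> sos n h \<Longrightarrow> sum f S \<in> sos n h"
  by (induction S rule: infinite_finite_induct) (auto simp: sos_add)

lemma sos_scale:
  assumes "p \<in> sos n h" "c \<ge> 0" shows "psmult (of_real c) p \<in> sos n h"
  using assms(1)
proof (induction rule: sos_induct)
  case (add p a)
  have "psmult (of_real c) (padj a \<star> a) = padj (psmult (of_real (sqrt c)) a) \<star> psmult (of_real (sqrt c)) a"
    using add assms(2) by (simp flip: of_real_mult)
  then show ?case using add sos_add_square[of _ "psmult (of_real (sqrt c)) a"]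
    by (simp only: psmult_add_right Balg_closed)
qed simp

lemma sos_conj:
  assumes "p \<in> sos n h" "b \<in> Balg n" shows "padj b \<star> (p \<star> b) \<in> sos n h"
  using assms(1)
proof (induction rule: sos_induct)
  case (add p a)
  then have "padj b \<star> ((p + padj a \<star> a) \<star> b) = padj b \<star> (p \<star> b) + padj (a \<star> b) \<star> (a \<star> b)"
    using assms(2) by (simp add: sos_Balg)
  then show ?case using add assms(2) by (simp only: sos_add_square Balg_wick)
qed simp

section \<open>The ideal generated by J - mu\<close>

definition jideal :: "cpoly set" where
  "jideal = {Jmu n \<mu> \<star> g | g. g \<in> Balg n}"

lemma jidealI: "g \<in> Balg n \<Longrightarrow> Jmu n \<mu> \<star> g \<in> jideal"
  by (auto simp: jideal_def)

lemma jidealI': "g \<in> Balg n \<Longrightarrow> g \<star> Jmu n \<mu> \<in> jideal"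
  by (simp add: Jmu_commute jidealI)

lemma jideal_Balg: "f \<in> jideal \<Longrightarrow> f \<in> Balg n"
  by (auto simp: jideal_def)

lemma jideal_zero [simp]: "0 \<in> jideal"
  using jidealI[of 0] by simp

lemma jideal_add: "f \<in> jideal \<Longrightarrow> g \<in> jideal \<Longrightarrow> f + g \<in> jideal"
proof -
  assume "f \<in> jideal" "g \<in> jideal"
  then obtain a b where "f = Jmu n \<mu> \<star> a" "g = Jmu n \<mu> \<star> b" "a \<in> Balg n" "b \<in> Balg n"
    by (auto simp: jideal_def)
  then show ?thesis using jidealI[of "a + b"] by simp
qed

lemma jideal_psmult: "f \<in> jideal \<Longrightarrow> psmult c f \<in> jideal"
proof -
  assume "f \<in> jideal"
  then obtain a where "f = Jmu n \<mu> \<star> a" "a \<in> Balg n" by (auto simp: jideal_def)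
  then show ?thesis using jidealI[of "psmult c a"] by simp
qed

lemma jideal_uminus: "f \<in> jideal \<Longrightarrow> - f \<in> jideal"
  using jideal_psmult[of f "-1"] by (simp add: psmult_minus_one)

lemma jideal_diff: "f \<in> jideal \<Longrightarrow> g \<in> jideal \<Longrightarrow> f - g \<in> jideal"
  using jideal_add[of f "- g"] jideal_uminus[of g] by simp

lemma jideal_wick_right: "f \<in> jideal \<Longrightarrow> a \<in> Balg n \<Longrightarrow> f \<star> a \<in> jideal"
  unfolding jideal_def by auto

lemma jideal_padj: "f \<in> jideal \<Longrightarrow> padj f \<in> jideal"
  unfolding jideal_def by (auto simp: Jmu_commute)

lemma jideal_wick_left: "f \<in> jideal \<Longrightarrow> a \<in> Balg n \<Longrightarrow> a \<star> f \<in> jideal"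
  using jideal_padj[OF jideal_wick_right[OF jideal_padj, of f "padj a"]] by (simp add: jideal_Balg)

lemma star_ideal_eq: "star_ideal n h (Jmu n \<mu>) = jideal"
proof
  have "Jmu n \<mu> \<in> jideal" using jidealI[of pone] by simp
  then show "star_ideal n h (Jmu n \<mu>) \<subseteq> jideal" unfolding star_ideal_def
    by (intro Inter_lower CollectI)
      (auto simp: jideal_Balg jideal_add jideal_psmult jideal_wick_left jideal_wick_right jideal_padj)
qed (auto simp: star_ideal_def jideal_def)

section \<open>The cone and calculation modulo the ideal\<close>

definition cone :: "cpoly set" where
  "cone = {p + q | p q. p \<in> sos n h \<and> q \<in> jideal \<and> padj q = q}"

lemma coneE:
  assumes "f \<in> cone"
  obtains p q where "f = p + q" "p \<in> sos n h" "q \<in> jideal" "padj q = q"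
  using assms by (auto simp: cone_def)

lemma cone_sos: "p \<in> sos n h \<Longrightarrow> p \<in> cone"
  unfolding cone_def by (intro CollectI exI[of _ p] exI[of _ 0]) simp

lemma cone_jideal: "q \<in> jideal \<Longrightarrow> padj q = q \<Longrightarrow> q \<in> cone"
  unfolding cone_def by (intro CollectI exI[of _ 0] exI[of _ q]) simp

lemma cone_zero [simp]: "0 \<in> cone"
  by (simp add: cone_sos)

lemma cone_Balg [simp]: "f \<in> cone \<Longrightarrow> f \<in> Balg n"
  by (auto elim!: coneE simp: sos_Balg jideal_Balg)

lemma cone_hermitian: "f \<in> cone \<Longrightarrow> padj f = f"
  by (auto elim!: coneE simp: sos_hermitian)

lemma cone_add: "f \<in> cone \<Longrightarrow> g \<in> cone \<Longrightarrow> f + g \<in> cone"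
proof (elim coneE)
  fix p q p' q'
  assume "f = p + q" "g = p' + q'" "p \<in> sos n h" "p' \<in> sos n h" "q \<in> jideal" "q' \<in> jideal"
    "padj q = q" "padj q' = q'"
  then show "f + g \<in> cone" unfolding cone_def
    by (intro CollectI exI[of _ "p + p'"] exI[of _ "q + q'"]) (simp add: sos_add jideal_add)
qed

lemma cone_sum: "\<forall>x\<in>S. f x \<in> cone \<Longrightarrow> sum f S \<in> cone"
  by (induction S rule: infinite_finite_induct) (auto simp: cone_add)

lemma cone_scale: "f \<in> cone \<Longrightarrow> c \<ge> 0 \<Longrightarrow> psmult (of_real c) f \<in> cone"
proof (elim coneE)
  fix p q assume "f = p + q" "p \<in> sos n h" "q \<in> jideal" "padj q = q" "c \<ge> 0"
  then show "psmult (of_real c) f \<in> cone" unfolding cone_def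
    by (intro CollectI exI[of _ "psmult (of_real c) p"] exI[of _ "psmult (of_real c) q"])
      (simp add: sos_scale jideal_psmult psmult_add_right)
qed

lemma cone_conj:
  assumes "f \<in> cone" "b \<in> Balg n" shows "padj b \<star> (f \<star> b) \<in> cone"
  using assms(1)
proof (elim coneE)
  fix p q assume "f = p + q" "p \<in> sos n h" "q \<in> jideal" "padj q = q"
  then show ?thesis unfolding cone_def using assms(2)
    by (intro CollectI exI[of _ "padj b \<star> (p \<star> b)"] exI[of _ "padj b \<star> (q \<star> b)"])
      (simp add: sos_conj jideal_wick_left jideal_wick_right jideal_Balg sos_Balg)
qed

text \<open>Lets J be replaced by mu in membership proofs. The difference is automatically
  Hermitian, so it belongs to the second summand of the cone.\<close>

lemma cone_cong:
  assumes "f \<in> cone" "g - f \<in> jideal" "padj g = g" shows "g \<in> cone"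
proof -
  have "padj (g - f) = g - f" using assms(3) cone_hermitian[OF assms(1)] by simp
  then have "f + (g - f) \<in> cone" by (rule cone_add[OF assms(1) cone_jideal[OF assms(2)]])
  then show ?thesis by simp
qed

section \<open>Admissible states and the easy inclusion\<close>

lemma padj_wick_Bpos:
  assumes "a \<in> Balg n" shows "padj a \<star> a \<in> Bpos n h"
proof -
  have "0 \<le> finner n h g (frep n h (padj a \<star> a) g)" if "g \<in> fock n" for g
    using that assms finner_frep_adjoint[of "padj a" g "frep n h a g"]
    by (simp add: finner_self_nonneg)
  then show ?thesis using assms by (simp add: Bpos_def)
qed

text \<open>Evaluate the state on the square of y + t (J - mu). The t^2 term is 0 by assumption, so
  the result is affine in t and its slope must vanish.\<close>

lemma state_jideal:
  assumes st: "is_state n h \<omega>" and 0: "\<omega> (Jmu n \<mu> \<star> Jmu n \<mu>) = 0" and f: "f \<in> jideal"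
  shows "\<omega> f = 0"
proof -
  let ?X = "Jmu n \<mu>"
  have \<omega>: "\<omega> (f + g) = \<omega> f + \<omega> g" "\<omega> (psmult c f) = c * \<omega> f" if "f \<in> Balg n" "g \<in> Balg n" for f g c
    using st that by (auto simp: is_state_def)
  have *: "\<omega> (padj y \<star> ?X) + \<omega> (?X \<star> y) = 0" if y: "y \<in> Balg n" for y
  proof (rule affine_nonneg_imp_zero)
    fix t :: real
    define z where "z = y + psmult t ?X"
    have "z \<in> Balg n" using y by (simp add: z_def)
    then have "0 \<le> \<omega> (padj z \<star> z)" using st padj_wick_Bpos by (auto simp: is_state_def)
    also have "padj z \<star> z = padj y \<star> y + (psmult t (padj y \<star> ?X + ?X \<star> y) + psmult (t * t) (?X \<star> ?X))"
      using y by (simp add: z_def psmult_add_right)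
    also have "\<omega> \<dots> = \<omega> (padj y \<star> y) + t * (\<omega> (padj y \<star> ?X) + \<omega> (?X \<star> y))"
      using y 0 by (simp add: \<omega>)
    finally show "0 \<le> \<omega> (padj y \<star> y) + t * (\<omega> (padj y \<star> ?X) + \<omega> (?X \<star> y))" .
  qed
  have "\<omega> (?X \<star> y) = 0" if y: "y \<in> Balg n" for y
  proof -
    \<comment> \<open>Replacing y by i y turns the vanishing sum into a vanishing difference, which
      separates the two terms.\<close>
    have "- \<i> * \<omega> (padj y \<star> ?X) + \<i> * \<omega> (?X \<star> y) = 0"
      using *[of "psmult \<i> y"] y \<omega>(2)[of _ pone] by simp
    then have "\<omega> (padj y \<star> ?X) = \<omega> (?X \<star> y)" by simp
    then show ?thesis using *[OF y] by simp
  qed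
  then show ?thesis using f by (auto simp: jideal_def)
qed

lemma cone_subset_Rred: "cone \<subseteq> Rred n h \<mu>"
proof
  fix f assume f: "f \<in> cone"
  have "0 \<le> \<omega> f" if st: "is_state n h \<omega>" "\<omega> (Jmu n \<mu> \<star> Jmu n \<mu>) = 0" for \<omega>
  proof -
    have \<omega>: "\<omega> (f + g) = \<omega> f + \<omega> g" "\<omega> (psmult c f) = c * \<omega> f" if "f \<in> Balg n" "g \<in> Balg n" for f g c
      using st that by (auto simp: is_state_def)
    have "0 \<le> \<omega> p" if "p \<in> sos n h" for p
      using that
    proof (induction rule: sos_induct)
      case zero
      show ?case using \<omega>(2)[of 0 0 0] by simp
    next
      case (add p a)
      have "0 \<le> \<omega> (padj a \<star> a)" using st(1) padj_wick_Bpos[of a] add by (simp add: is_state_def)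
      then show ?case using add by (simp add: \<omega> sos_Balg)
    qed
    then show ?thesis using f state_jideal[OF st] by (auto elim!: coneE simp: \<omega> sos_Balg jideal_Balg)
  qed
  then show "f \<in> Rred n h \<mu>" using f by (simp add: Rred_def cone_hermitian)
qed

text \<open>The normalized vector state of \<psi> is admissible: (J - mu) \<psi> = 0 makes its value
  on the square of J - mu vanish.\<close>

lemma Rred_expectation:
  assumes f: "f \<in> Rred n h \<mu>" and \<psi>: "\<psi> \<in> fock n" and J: "frep n h (Jmu n \<mu>) \<psi> = 0"
  shows "0 \<le> finner n h \<psi> (frep n h f \<psi>)"
proof (cases "\<psi> = 0")
  case False
  define N where "N = Re (finner n h \<psi> \<psi>)"
  have N: "finner n h \<psi> \<psi> = of_real N" "N \<ge> 0"
    using finner_self_nonneg[of \<psi>] by (auto simp: N_def less_eq_complex_def complex_eq_iff)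
  then have Np: "N > 0" using finner_self_neq_0[OF \<psi> False] by (simp add: less_le)
  define \<omega> where "\<omega> = (\<lambda>f. of_real (1 / N) * finner n h \<psi> (frep n h f \<psi>))"
  have "is_state n h \<omega>"
    unfolding is_state_def
  proof (intro conjI ballI allI impI)
    show "\<omega> pone = 1" using \<psi> N(1) Np by (simp add: \<omega>_def)
    fix f assume "f \<in> Balg n" "padj f = f"
    then have "cnj (\<omega> f) = \<omega> f" unfolding \<omega>_def
      using finner_frep_adjoint[of f \<psi> \<psi>] \<psi> finner_commute[of "frep n h f \<psi>" \<psi>] by simp
    then show "\<omega> f \<in> \<real>" by (simp add: Reals_cnj_iff)
  next
    fix f assume "f \<in> Bpos n h"
    then show "0 \<le> \<omega> f" using Np \<psi> unfolding \<omega>_def Bpos_def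
      by (auto simp: less_eq_complex_def)
  qed (use \<psi> in \<open>auto simp: \<omega>_def add_divide_distrib\<close>)
  moreover have "\<omega> (Jmu n \<mu> \<star> Jmu n \<mu>) = 0" using \<psi> J by (simp add: \<omega>_def)
  ultimately have "0 \<le> \<omega> f" using f by (simp add: Rred_def)
  then show ?thesis using Np by (auto simp: \<omega>_def less_eq_complex_def zero_le_divide_iff)
qed simp

end

section \<open>Positive semidefinite matrices and powers of J\<close>

text \<open>Cholesky elimination of one index s at a time. A zero pivot forces the whole row of s to
  vanish; otherwise a rank-one matrix is split off and the Schur complement is again positive
  semidefinite.\<close>

lemma psd_rank_one_decomposition:
  fixes Q :: "'a \<Rightarrow> 'a \<Rightarrow> complex"
  assumes "finite S" "\<And>x y. x \<in> S \<Longrightarrow> y \<in> S \<Longrightarrow> Q y x = cnj (Q x y)"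
    "\<And>v. 0 \<le> (\<Sum>x\<in>S. \<Sum>y\<in>S. cnj (v x) * Q x y * v y)"
  shows "\<exists>(m::nat) a. \<forall>x\<in>S. \<forall>y\<in>S. Q x y = (\<Sum>j<m. a j x * cnj (a j y))"
  using assms
proof (induction S arbitrary: Q rule: finite_induct)
  case empty
  then show ?case by simp
next
  case (insert s S)
  note herm = insert.prems(1) and psd = insert.prems(2)
  define d where "d = Re (Q s s)"
  define b where "b v = (\<Sum>y\<in>S. Q s y * v y)" for v
  define q where "q v = (\<Sum>x\<in>S. \<Sum>y\<in>S. cnj (v x) * Q x y * v y)" for v
  have form: "0 \<le> cnj c * c * Q s s + cnj c * b v + cnj (b v) * c + q v" for c v
  proof -
    let ?v = "v(s := c)"
    have vS: "?v x = v x" if "x \<in> S" for x using that insert.hyps by auto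
    have "(\<Sum>x\<in>insert s S. \<Sum>y\<in>insert s S. cnj (?v x) * Q x y * ?v y)
      = cnj c * Q s s * c + (\<Sum>y\<in>S. cnj c * Q s y * v y) +
        ((\<Sum>x\<in>S. cnj (v x) * Q x s * c) + (\<Sum>x\<in>S. \<Sum>y\<in>S. cnj (v x) * Q x y * v y))"
      using insert.hyps vS by (simp add: sum.distrib cong: sum.cong)
    also have "(\<Sum>y\<in>S. cnj c * Q s y * v y) = cnj c * b v"
      by (simp add: b_def sum_distrib_left mult_ac)
    also have "(\<Sum>x\<in>S. cnj (v x) * Q x s * c) = (\<Sum>x\<in>S. cnj (Q s x * v x) * c)"
      using herm[of s] by (intro sum.cong) (auto simp: mult_ac)
    also have "\<dots> = cnj (b v) * c"
      by (simp add: b_def sum_distrib_right)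
    finally show ?thesis using psd[of ?v] by (simp add: q_def mult_ac add_ac)
  qed
  have "0 \<le> Q s s" using form[of 1 "\<lambda>_. 0"] by (simp add: b_def q_def)
  then have Qss: "Q s s = of_real d" and d: "d \<ge> 0"
    by (auto simp: d_def less_eq_complex_def complex_eq_iff)
  have b_single: "b (\<lambda>y. if y = x then t else 0) = Q s x * t" if "x \<in> S" for x t
  proof -
    have "b (\<lambda>y. if y = x then t else 0) = (\<Sum>y\<in>S. if y = x then Q s x * t else 0)"
      unfolding b_def by (intro sum.cong) auto
    then show ?thesis using insert.hyps that by simp
  qed
  show ?case
  proof (cases "d = 0")
    case True
    have Q0: "Q s x = 0" if x: "x \<in> S" for x
    proof -
      let ?e = "\<lambda>y. if y = x then 1 else 0 :: complex"
      \<comment> \<open>The vector with entry t * Q s x at s and 1 at x has a form value affine in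
        t, because the t^2 term carries the zero pivot.\<close>
      have "2 * (Q s x * cnj (Q s x)) = 0"
      proof (rule affine_nonneg_imp_zero)
        fix t :: real
        show "0 \<le> q ?e + of_real t * (2 * (Q s x * cnj (Q s x)))"
          using form[of "of_real t * Q s x" ?e] b_single[OF x, of 1] True
          by (simp add: Qss algebra_simps)
      qed
      then show ?thesis by simp
    qed
    have "\<exists>(m::nat) a. \<forall>x\<in>S. \<forall>y\<in>S. Q x y = (\<Sum>j<m. a j x * cnj (a j y))"
      using form[of 0] by (intro insert.IH herm) (auto simp: q_def)
    then obtain m :: nat and a where a: "\<forall>x\<in>S. \<forall>y\<in>S. Q x y = (\<Sum>j<m. a j x * cnj (a j y))" by blast
    have "Q x s = 0" if "x \<in> S" for x using Q0[OF that] herm[of s x] that by simp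
    then show ?thesis using a Q0 insert.hyps True Qss
      by (intro exI[of _ m] exI[of _ "\<lambda>j x. if x = s then 0 else a j x"])
        (auto intro!: sum.cong)
  next
    case False
    with d have dp: "d > 0" by simp
    \<comment> \<open>The column of s divided by the square root of the pivot, so that
      \<open>Q'\<close> below is the Schur complement.\<close>
    define a\<^sub>0 where "a\<^sub>0 x = Q x s / of_real (sqrt d)" for x
    have aa: "a\<^sub>0 x * cnj (a\<^sub>0 y) = Q x s * cnj (Q y s) / of_real d" for x y
      using dp by (simp add: a\<^sub>0_def flip: of_real_mult)
    define Q' where "Q' x y = Q x y - a\<^sub>0 x * cnj (a\<^sub>0 y)" for x y
    have "\<exists>(m::nat) a. \<forall>x\<in>S. \<forall>y\<in>S. Q' x y = (\<Sum>j<m. a j x * cnj (a j y))"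
    proof (rule insert.IH)
      show "Q' y x = cnj (Q' x y)" if "x \<in> S" "y \<in> S" for x y
        using herm[of x y] that by (simp add: Q'_def)
      fix v
      have 1: "(\<Sum>x\<in>S. \<Sum>y\<in>S. cnj (v x) * (a\<^sub>0 x * cnj (a\<^sub>0 y)) * v y) = cnj (b v) * b v / of_real d"
      proof -
        have "(\<Sum>x\<in>S. \<Sum>y\<in>S. cnj (v x) * (a\<^sub>0 x * cnj (a\<^sub>0 y)) * v y)
           = (\<Sum>x\<in>S. \<Sum>y\<in>S. cnj (Q s x * v x) * (Q s y * v y) / of_real d)"
          using herm[of s] unfolding aa by (intro sum.cong refl) simp
        also have "\<dots> = (\<Sum>x\<in>S. cnj (Q s x * v x)) * (\<Sum>y\<in>S. Q s y * v y) / of_real d"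
          unfolding sum_product by (simp only: sum_divide_distrib)
        finally show ?thesis unfolding b_def by simp
      qed
      have "(\<Sum>x\<in>S. \<Sum>y\<in>S. cnj (v x) * Q' x y * v y) = q v - cnj (b v) * b v / of_real d"
        unfolding 1[symmetric] q_def Q'_def by (simp add: algebra_simps sum_subtractf)
      \<comment> \<open>The entry c = - b v / d at s minimizes the form, and the minimum is the form
        of the Schur complement.\<close>
      also have "\<dots> = cnj (- b v / of_real d) * (- b v / of_real d) * Q s s + cnj (- b v / of_real d) * b v
          + cnj (b v) * (- b v / of_real d) + q v"
        using dp by (simp add: Qss field_simps)
      also have "0 \<le> \<dots>" by (rule form)
      finally show "0 \<le> (\<Sum>x\<in>S. \<Sum>y\<in>S. cnj (v x) * Q' x y * v y)" .
    qed
    then obtain m :: nat and a where a: "\<forall>x\<in>S. \<forall>y\<in>S. Q' x y = (\<Sum>j<m. a j x * cnj (a j y))" by blast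
    \<comment> \<open>Index m carries the pivot vector; the vectors found for S are extended by 0 at
      s.\<close>
    define a' where "a' = (\<lambda>j x. if j = m then a\<^sub>0 x else if x = s then 0 else a j x)"
    have "Q x y = (\<Sum>j<Suc m. a' j x * cnj (a' j y))" if xy: "x \<in> insert s S" "y \<in> insert s S" for x y
    proof (cases "x = s \<or> y = s")
      case True
      then have "(\<Sum>j<m. a' j x * cnj (a' j y)) = 0" by (intro sum.neutral) (auto simp: a'_def)
      moreover have "Q x s * cnj (Q y s) / of_real d = Q x y"
        using True herm[of s s] herm[of y s] herm[of s y] xy dp by (auto simp: Qss)
      ultimately show ?thesis by (simp add: a'_def aa)
    next
      case False
      then have "x \<in> S" "y \<in> S" using xy by auto
      moreover have "(\<Sum>j<m. a' j x * cnj (a' j y)) = (\<Sum>j<m. a j x * cnj (a j y))"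
        using False by (intro sum.cong) (auto simp: a'_def)
      ultimately show ?thesis using a Q'_def[of x y] by (simp add: a'_def)
    qed
    then show ?thesis by blast
  qed
qed

section \<open>Bidegree (k,k) and powers of J\<close>

definition homog :: "nat \<Rightarrow> nat \<Rightarrow> cpoly \<Rightarrow> bool" where
  "homog n k f \<longleftrightarrow> f \<in> polys n \<and> (\<forall>K L. f K L \<noteq> 0 \<longrightarrow> mdeg n K = k \<and> mdeg n L = k)"

lemma homog_Balg: "homog n k f \<Longrightarrow> f \<in> Balg n"
proof -
  assume f: "homog n k f"
  then have "mdeg n K = mdeg n L" if "f K L \<noteq> 0" for K L
    using that unfolding homog_def by presburger
  with f show ?thesis by (auto simp only: homog_def Balg_def)
qed

lemma homog_0 [simp]: "homog n k 0"
  by (simp add: homog_def fun_ops)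

lemma homog_add [simp]: "homog n k f \<Longrightarrow> homog n k g \<Longrightarrow> homog n k (f + g)"
proof -
  have "(f + g) K L \<noteq> 0 \<Longrightarrow> f K L \<noteq> 0 \<or> g K L \<noteq> 0" for K L by (auto simp: fun_ops)
  then show "homog n k f \<Longrightarrow> homog n k g \<Longrightarrow> homog n k (f + g)"
    unfolding homog_def by (meson polys_add)
qed

lemma homog_psmult [simp]: "homog n k f \<Longrightarrow> homog n k (psmult c f)"
proof -
  have "psmult c f K L \<noteq> 0 \<Longrightarrow> f K L \<noteq> 0" for K L by (auto simp: psmult_def)
  then show "homog n k f \<Longrightarrow> homog n k (psmult c f)"
    unfolding homog_def by (meson polys_psmult)
qed

lemma homog_padj [simp]: "homog n k f \<Longrightarrow> homog n k (padj f)"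
  unfolding homog_def by (simp, simp add: padj_def)

lemma homog_zmono [simp]:
  "mi_on n K \<Longrightarrow> mi_on n L \<Longrightarrow> mdeg n K = k \<Longrightarrow> mdeg n L = k \<Longrightarrow> homog n k (zmono K L)"
  by (simp add: homog_def) (simp add: zmono_def)

lemma homog_sum [simp]: "\<forall>x\<in>S. homog n k (f x) \<Longrightarrow> homog n k (sum f S)"
  by (induction S rule: infinite_finite_induct) auto

lemma homog_induct [consumes 1, case_names zmono zero add psmult]:
  assumes "homog n k f"
    and "\<And>K L. mi_on n K \<Longrightarrow> mi_on n L \<Longrightarrow> mdeg n K = k \<Longrightarrow> mdeg n L = k \<Longrightarrow> P (zmono K L)"
    and "P 0"
    and "\<And>f g. f \<in> polys n \<Longrightarrow> g \<in> polys n \<Longrightarrow> P f \<Longrightarrow> P g \<Longrightarrow> P (f + g)"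
    and "\<And>c f. f \<in> polys n \<Longrightarrow> P f \<Longrightarrow> P (psmult c f)"
  shows "P f"
proof -
  have "f \<in> polys n" using assms(1) by (simp add: homog_def)
  then show ?thesis
  proof (rule finite_psupp_induct)
    fix K L assume "f K L \<noteq> 0"
    then show "P (zmono K L)" using assms(1,2) by (simp add: homog_def polys_def)
  qed (use assms in auto)
qed

lemma homog_Jmul:
  assumes "homog n k f" shows "homog n (Suc k) (Jmul n f)"
  using assms
proof (induction rule: homog_induct)
  case (zmono K L)
  then show ?case by (simp add: Jmul_zmono)
qed auto

text \<open>The pointwise power of J, not the star power. Its coefficient at z^K zbar^K is the
  multinomial m!/K!, of which only positivity is used.\<close>

primrec Jpow :: "nat \<Rightarrow> nat \<Rightarrow> cpoly" where
  "Jpow n 0 = pone"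
| "Jpow n (Suc m) = Jmul n (Jpow n m)"

lemma homog_Jpow: "homog n m (Jpow n m)"
  by (induction m) (auto simp: homog_Jmul pone_zmono)

lemma Jpow_offdiag: "A \<noteq> B \<Longrightarrow> Jpow n m A B = 0"
proof (induction m arbitrary: A B)
  case (Suc m)
  have "Jpow n m (msub A (unitmi j)) (msub B (unitmi j)) = 0" if "A j > 0" "B j > 0" for j
  proof (rule Suc.IH)
    show "msub A (unitmi j) \<noteq> msub B (unitmi j)"
    proof
      assume e: "msub A (unitmi j) = msub B (unitmi j)"
      have "A i = B i" for i
        using fun_cong[OF e, of i] that by (auto simp: msub_def unitmi_def split: if_splits)
      then show False using Suc.prems by auto
    qed
  qed
  then show ?case by (auto simp: Jmul_def intro!: sum.neutral)
qed (auto simp: pone_def)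

lemma Jpow_nonneg: "0 \<le> Jpow n m A B"
proof (induction m arbitrary: A B)
  case (Suc m)
  then show ?case by (auto simp: Jmul_def intro!: sum_nonneg)
qed (simp add: pone_def less_eq_complex_def)

lemma mdeg_msub_unitmi:
  assumes "j \<le> n" "A j > 0" shows "Suc (mdeg n (msub A (unitmi j))) = mdeg n A"
proof -
  have "A = (\<lambda>i. msub A (unitmi j) i + unitmi j i)"
    using assms(2) by (auto simp: fun_eq_iff msub_def unitmi_def)
  then have "mdeg n A = mdeg n (\<lambda>i. msub A (unitmi j) i + unitmi j i)" by simp
  then show ?thesis using assms(1) by simp
qed

lemma Jpow_diag_neq_0: "mi_on n A \<Longrightarrow> mdeg n A = m \<Longrightarrow> Jpow n m A A \<noteq> 0"
proof (induction m arbitrary: A)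
  case 0
  then have "A i = 0" for i by (cases "i \<le> n") (auto simp: mi_on_def mdeg_def)
  then show ?case by (simp add: pone_def fun_eq_iff)
next
  case (Suc m)
  then obtain j where j: "j \<le> n" "A j > 0"
    unfolding mdeg_def by (metis atMost_iff gr0I sum.neutral Zero_not_Suc)
  have "Jpow n m (msub A (unitmi j)) (msub A (unitmi j)) \<noteq> 0"
    using Suc.prems mdeg_msub_unitmi[of j n A, OF j] by (intro Suc.IH) (auto simp: mi_on_def msub_def)
  then have "\<not> (\<forall>i\<in>{..n}. (if A i > 0 \<and> A i > 0 then Jpow n m (msub A (unitmi i)) (msub A (unitmi i)) else 0) = 0)"
    using j by auto
  then have "(\<Sum>i\<le>n. if A i > 0 \<and> A i > 0 then Jpow n m (msub A (unitmi i)) (msub A (unitmi i)) else 0) \<noteq> 0"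
    by (subst sum_nonneg_eq_0_iff) (auto simp: Jpow_nonneg)
  then show ?case by (simp add: Jmul_def)
qed

text \<open>Positive coefficients put the sum into the cone together with its terms; that every K of
  degree m occurs is what \<open>zmono_diag_lin\<close> relies on.\<close>

lemma Jpow_expand:
  obtains S c where "finite S" "\<forall>K. K \<in> S \<longleftrightarrow> mi_on n K \<and> mdeg n K = m"
    "\<forall>K\<in>S. c K > (0::real)" "Jpow n m = (\<Sum>K\<in>S. psmult (of_real (c K)) (zmono K K))"
proof
  let ?c = "\<lambda>K. Re (Jpow n m K K)"
  let ?S = "fst ` psupp (Jpow n m)"
  have fin: "finite (psupp (Jpow n m))" 
    by (rule polysD_finite[OF Balg_polys[OF homog_Balg[OF homog_Jpow]]])
  then show "finite ?S" by simp
  have c: "Jpow n m K K = of_real (?c K)" "0 \<le> ?c K" for K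
    using Jpow_nonneg[of n m K K] by (auto simp: less_eq_complex_def complex_eq_iff)
  have S: "K \<in> ?S \<longleftrightarrow> Jpow n m K K \<noteq> 0" for K
    using Jpow_offdiag[of K] by (force simp: psupp_def)
  then show "\<forall>K. K \<in> ?S \<longleftrightarrow> mi_on n K \<and> mdeg n K = m"
    using Jpow_diag_neq_0[of n _ m] homog_Jpow[of n m] by (auto simp: homog_def polys_def)
  show "\<forall>K\<in>?S. ?c K > 0"
  proof
    fix K assume "K \<in> ?S"
    then show "?c K > 0" using c[of K] S[of K] by (metis less_le of_real_0)
  qed
  have sup: "psupp (Jpow n m) = (\<lambda>K. (K, K)) ` ?S"
    using Jpow_offdiag by (force simp: psupp_def)
  have "Jpow n m = (\<Sum>(K, L)\<in>psupp (Jpow n m). psmult (Jpow n m K L) (zmono K L))"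
    using fin by (rule cpoly_expand) simp
  also have "\<dots> = (\<Sum>K\<in>?S. psmult (Jpow n m K K) (zmono K K))"
    by (subst sup, subst sum.reindex) (auto simp: inj_on_def)
  finally show "Jpow n m = (\<Sum>K\<in>?S. psmult (of_real (?c K)) (zmono K K))"
    by (simp only: c(1)[symmetric])
qed

section \<open>Rising factorials of J and inserted squares\<close>

context wick_reduction
begin

text \<open>The product of J + h (s + i) over i < r. The recursion splits off the lowest factor
  because each insertion in \<open>rising_graded_sos\<close> adds a new lowest one.\<close>

primrec rising :: "nat \<Rightarrow> real \<Rightarrow> cpoly" where
  "rising 0 s = pone"
| "rising (Suc r) s = rising r (s + 1) \<star> (Jpoly n + psmult (h * s) pone)"

lemma rising_Balg [simp]: "rising r s \<in> Balg n"
  by (induction r arbitrary: s) auto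

lemma rising_mod_jideal:
  "rising r s - psmult (of_real (\<Prod>i<r. \<mu> + h * (s + real i))) pone \<in> jideal"
proof (induction r arbitrary: s)
  case (Suc r)
  let ?c = "\<Prod>i<r. \<mu> + h * (s + 1 + real i)"
  have c: "(\<Prod>i<Suc r. \<mu> + h * (s + real i)) = (\<mu> + h * s) * ?c"
    by (subst prod.lessThan_Suc_shift) (simp add: algebra_simps)
  \<comment> \<open>With R the shorter product and c its value, (R - c) (J + h s) + c (J - mu) = R
    (J + h s) - c (mu + h s).\<close>
  have "(rising r (s + 1) - psmult ?c pone) \<star> (Jpoly n + psmult (h * s) pone)
      + psmult ?c pone \<star> Jmu n \<mu> \<in> jideal"
    using Suc[of "s + 1"] by (intro jideal_add jideal_wick_right jidealI') auto
  also have "(rising r (s + 1) - psmult ?c pone) \<star> (Jpoly n + psmult (h * s) pone)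
      + psmult ?c pone \<star> Jmu n \<mu> = rising (Suc r) s - psmult (of_real (\<Prod>i<Suc r. \<mu> + h * (s + real i))) pone"
    unfolding c
    by (simp add: Jmu_def psmult_add_right psmult_diff_right psmult_add_left distrib_right mult_ac del: of_real_prod)
  finally show ?case .
qed simp

text \<open>The origin of n + 1: zbar_j \<star> z_j multiplies z^B by h (B_j + 1), so each mode
  contributes one extra h.\<close>

lemma antinormal_number: "(\<Sum>j\<le>n. zmono (\<lambda>_. 0) (unitmi j) \<star> zmono (unitmi j) (\<lambda>_. 0))
   = Jpoly n + psmult (h * (n + 1)) pone"
proof (rule frep_eqI)
  fix B assume B: "mi_on n B"
  have "frep n h (zmono (\<lambda>_. 0) (unitmi j) \<star> zmono (unitmi j) (\<lambda>_. 0)) (hbase B)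
     = hsmult (h * (B j + 1)) (hbase B)" if j: "j \<le> n" for j
  proof -
    have "mi_on n (\<lambda>i. unitmi j i + B i)" using B j by simp
    moreover have "ffact (\<lambda>_. 0) B = 1" by (simp add: ffact_def)
    ultimately show ?thesis using B j
      by (simp add: frep_mono ffact_unitmi) (simp add: unitmi_def add.commute)
  qed
  then have "frep n h (\<Sum>j\<le>n. zmono (\<lambda>_. 0) (unitmi j) \<star> zmono (unitmi j) (\<lambda>_. 0)) (hbase B)
      = (\<Sum>j\<le>n. hsmult (h * (B j + 1)) (hbase B))"
    using B by (subst frep_sum_left) auto
  also have "\<dots> = frep n h (Jpoly n + psmult (h * (n + 1)) pone) (hbase B)"
    using B by (simp add: frep_Jpoly_hbase)
      (simp add: fun_eq_iff fun_ops hsmult_def sum_fun_apply mdeg_def sum_distrib_left sum.distrib algebra_simps)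
  finally show "frep n h (\<Sum>j\<le>n. zmono (\<lambda>_. 0) (unitmi j) \<star> zmono (unitmi j) (\<lambda>_. 0)) (hbase B)
     = frep n h (Jpoly n + psmult (h * (n + 1)) pone) (hbase B)" .
qed auto

text \<open>Inserting zbar_j \<star> z_j between g and its adjoint gives elements
  \<open>gj j\<close> of difference r, to which the induction hypothesis applies. Their squares sum
  to g \<star> (J + h (n + 1)) \<star> padj g, and moving J to the left of g, of difference r + 1,
  leaves the new factor J + h (n + 1 - (r + 1)).\<close>

lemma rising_graded_sos:
  "graded n (int r) g \<Longrightarrow> rising r (real n + 1 - real r) \<star> (g \<star> padj g) \<in> sos n h"
proof (induction r arbitrary: g)
  case 0
  then have "g \<in> Balg n" by (simp add: Balg_graded)
  then show ?case using sos_square[of "padj g"] by simp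
next
  case (Suc r)
  let ?s = "real n + 1 - real r"
  have g: "g \<in> polys n" using Suc.prems by (rule gradedD)
  have J: "g \<star> Jpoly n = Jpoly n \<star> g - psmult (h * (r + 1)) g"
    using Jpoly_graded_commute[OF Suc.prems] by (simp add: add.commute)
  define gj where "gj j = g \<star> zmono (\<lambda>_. 0) (unitmi j)" for j
  have "rising r ?s \<star> (gj j \<star> padj (gj j)) \<in> sos n h" if "j \<le> n" for j
  proof (rule Suc.IH)
    show "graded n (int r) (gj j)"
      unfolding gj_def using that graded_wick[OF Suc.prems, of "-1" "zmono (\<lambda>_. 0) (unitmi j)"] by simp
  qed
  then have "(\<Sum>j\<le>n. rising r ?s \<star> (gj j \<star> padj (gj j))) \<in> sos n h"
    by (intro sos_sum) simp
  also have "(\<Sum>j\<le>n. rising r ?s \<star> (gj j \<star> padj (gj j))) =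
     rising r ?s \<star> (g \<star> ((\<Sum>j\<le>n. zmono (\<lambda>_. 0) (unitmi j) \<star> zmono (unitmi j) (\<lambda>_. 0)) \<star> padj g))"
    using g by (simp add: gj_def wick_sum_left wick_sum_right)
  also have "\<dots> = rising r ?s \<star> ((g \<star> Jpoly n + psmult (h * (n + 1)) g) \<star> padj g)"
    unfolding antinormal_number using g by simp
  also have "\<dots> = rising (Suc r) (real n + 1 - real (Suc r)) \<star> (g \<star> padj g)"
  proof -
    have "real n + 1 - real (Suc r) + 1 = ?s" by simp
    moreover have "psmult (h * (real n + 1 - real (Suc r))) g = psmult (h * (n + 1)) g - psmult (h * (r + 1)) g"
      unfolding psmult_diff_left[symmetric] by (simp add: algebra_simps)
    then have "g \<star> Jpoly n + psmult (h * (n + 1)) g = (Jpoly n + psmult (h * (real n + 1 - real (Suc r))) pone) \<star> g"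
      unfolding J using g by (simp del: of_real_add of_real_diff of_real_mult of_real_of_nat_eq)
    moreover have e: "real n - real r + 1 = ?s" by simp
    ultimately show ?thesis using g by (simp add: e)
  qed
  finally show ?case .
qed

end

section \<open>The positive cone of the reduction\<close>

context wick_reduction
begin

text \<open>Modulo the ideal the rising factorial is the number c, so
  \<open>rising_graded_sos\<close> puts c times the element into the cone. Hypothesis
  \<open>pos\<close> is positivity of the smallest factor of c, which permits division by c.\<close>

lemma cone_graded_square:
  assumes g: "graded n (int r) g" and pos: "\<mu> + h * (real n + 1 - real r) > 0"
  shows "g \<star> padj g \<in> cone"
proof -
  let ?s = "real n + 1 - real r" and ?G = "g \<star> padj g"
  define c where "c = (\<Prod>i<r. \<mu> + h * (?s + real i))"
  have "c > 0" unfolding c_def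
  proof (intro prod_pos ballI)
    fix i
    have "h * ?s \<le> h * (?s + real i)" using h_pos by simp
    then show "\<mu> + h * (?s + real i) > 0" using pos by linarith
  qed
  have gp: "g \<in> polys n" using g by (rule gradedD)
  have G: "?G \<in> Balg n" using graded_wick[OF g graded_padj[OF g]] by (simp add: Balg_graded)
  have "(rising r ?s - psmult (of_real c) pone) \<star> ?G \<in> jideal"
    using rising_mod_jideal[of r ?s] G unfolding c_def by (intro jideal_wick_right)
  then have "- ((rising r ?s - psmult (of_real c) pone) \<star> ?G) \<in> jideal" by (rule jideal_uminus)
  also have "- ((rising r ?s - psmult (of_real c) pone) \<star> ?G) = psmult (of_real c) ?G - rising r ?s \<star> ?G"
    using G gp by simp
  finally have "psmult (of_real c) ?G \<in> cone"
    using rising_graded_sos[OF g] gp by (intro cone_cong[OF cone_sos]) auto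
  then have "psmult (of_real (1 / c)) (psmult (of_real c) ?G) \<in> cone"
    by (rule cone_scale) (use \<open>c > 0\<close> in simp)
  then show ?thesis using \<open>c > 0\<close> by simp
qed

text \<open>By \<open>Jmul_wick\<close> the pointwise factor J acts in bidegree (m,m) as the star
  factor J - h m, so the falling factors appear one by one.\<close>

lemma Jpow_mod_jideal:
  "Jpow n m - psmult (of_real (\<Prod>i<m. \<mu> - h * real i)) pone \<in> jideal"
proof (induction m)
  case (Suc m)
  let ?c = "\<Prod>i<m. \<mu> - h * real i"
  have B: "Jpow n m \<in> Balg n" using homog_Jpow by (rule homog_Balg)
  have "(Jpow n m - psmult ?c pone) \<star> (Jpoly n - psmult (h * m) pone) + psmult ?c pone \<star> Jmu n \<mu> \<in> jideal"
    using Suc by (intro jideal_add jideal_wick_right jidealI') auto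
  also have "Jpow n (Suc m) = Jpow n m \<star> (Jpoly n - psmult (h * m) pone)"
    using homog_Jpow[of n m] unfolding Jpow.simps homog_def by (intro Jmul_wick) blast+
  then have "(Jpow n m - psmult ?c pone) \<star> (Jpoly n - psmult (h * m) pone) + psmult ?c pone \<star> Jmu n \<mu>
    = Jpow n (Suc m) - psmult (of_real (\<Prod>i<Suc m. \<mu> - h * real i)) pone"
    using B by (simp add: Jmu_def psmult_diff_right psmult_diff_left right_diff_distrib left_diff_distrib mult_ac del: Jpow.simps of_real_prod)
  finally show ?case .
qed simp

lemma zmono_square: "mi_on n K \<Longrightarrow> mi_on n L \<Longrightarrow> zmono K (\<lambda>_. 0) \<star> padj (zmono L (\<lambda>_. 0)) = zmono K L"
  by (simp add: wick_zmono_right)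

lemma zmono_diag_cone:
  assumes "mi_on n K" "mdeg n K = r" "\<mu> + h * (real n + 1 - real r) > 0"
  shows "zmono K K \<in> cone"
  using cone_graded_square[of r "zmono K (\<lambda>_. 0)"] assms zmono_square[of K K] by simp

text \<open>4 f = (f + 1)^2 - (f - 1)^2, and the negative square is -1 conjugated by f - 1.\<close>

lemma cone_everything:
  assumes m: "- pone \<in> cone" and f: "f \<in> Balg n" "padj f = f"
  shows "f \<in> cone"
proof -
  let ?a = "f + pone" and ?b = "f - pone"
  have "padj ?a \<star> ?a + padj ?b \<star> ((- pone) \<star> ?b) \<in> cone"
    using f by (intro cone_add[OF cone_sos[OF sos_square] cone_conj[OF m]]) auto
  also have "padj ?a \<star> ?a + padj ?b \<star> ((- pone) \<star> ?b) = psmult (1 + 1 + 1 + 1) f"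
    using f unfolding psmult_add_left by simp
  finally have "psmult (of_real (1 / 4)) (psmult (1 + 1 + 1 + 1) f) \<in> cone"
    by (rule cone_scale) simp
  then show ?thesis by simp
qed

lemma cone_nonintegral:
  assumes "n \<ge> 1" "\<mu> \<ge> 0" and non: "\<And>k::nat. \<mu> \<noteq> h * k" and f: "f \<in> Balg n" "padj f = f"
  shows "f \<in> cone"
proof -
  define p where "p = nat \<lfloor>\<mu> / h\<rfloor>"
  have "0 \<le> \<mu> / h" using assms h_pos by simp
  then have "real p \<le> \<mu> / h" "\<mu> / h < real p + 1" by (auto simp: p_def)
  then have p: "h * real p < \<mu>" "\<mu> < h * (real p + 1)"
    using h_pos non[of p] by (auto simp: field_simps less_le)
  \<comment> \<open>The factors mu - h i are positive up to i = p and negative at i = p + 1, so p +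
    2 factors contain exactly one negative factor.\<close>
  define r where "r = p + 2"
  define c where "c = (\<Prod>i<r. \<mu> - h * real i)"
  have "c < 0"
  proof -
    have "(\<Prod>i<Suc p. \<mu> - h * real i) > 0"
    proof (intro prod_pos ballI)
      fix i assume "i \<in> {..<Suc p}"
      then have "h * real i \<le> h * real p" using h_pos by simp
      then show "\<mu> - h * real i > 0" using p by linarith
    qed
    moreover have "c = (\<Prod>i<Suc p. \<mu> - h * real i) * (\<mu> - h * (real p + 1))"
      by (simp add: c_def r_def add.commute)
    ultimately show ?thesis using p by (simp add: mult_pos_neg)
  qed
  \<comment> \<open>The condition equals (mu - h p) + (h n - h) > 0: the first bracket is positive,
    and the second is nonnegative because n \<ge> 1.\<close>
  have "h * 1 \<le> h * real n" using h_pos assms(1) by simp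
  moreover have "h * (real n + 1 - real r) = h * real n - h * real p - h" by (simp add: r_def algebra_simps)
  ultimately have pos: "\<mu> + h * (real n + 1 - real r) > 0" using p by linarith
  obtain S d where S: "finite S" "\<forall>K. K \<in> S \<longleftrightarrow> mi_on n K \<and> mdeg n K = r"
    "\<forall>K\<in>S. d K > (0::real)" "Jpow n r = (\<Sum>K\<in>S. psmult (of_real (d K)) (zmono K K))"
    by (rule Jpow_expand[where n = n and m = r])
  have "Jpow n r \<in> cone" unfolding S(4) using S(2,3) pos
    by (intro cone_sum ballI cone_scale zmono_diag_cone) (auto simp: less_imp_le)
  moreover have "psmult (of_real c) pone - Jpow n r \<in> jideal"
    using jideal_uminus[OF Jpow_mod_jideal[of r]] by (simp add: c_def)
  ultimately have "psmult (of_real c) pone \<in> cone" by (rule cone_cong) simp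
  then have "psmult (of_real (- 1 / c)) (psmult (of_real c) pone) \<in> cone"
    by (rule cone_scale) (use \<open>c < 0\<close> in \<open>simp add: divide_nonpos_neg\<close>)
  then have "- pone \<in> cone" using \<open>c < 0\<close> by (simp add: psmult_uminus_left)
  then show ?thesis using f by (rule cone_everything)
qed

section \<open>The lineality space and its complexification\<close>

definition lin :: "cpoly set" where
  "lin = {y. y \<in> cone \<and> - y \<in> cone}"

text \<open>The complexification is encoded by the two Hermitian components of x. Their factors 1/2
  are dropped since \<open>lin\<close> is a real vector space, and the factor i makes the second
  component Hermitian.\<close>

definition null :: "cpoly set" where
  "null = {x \<in> Balg n. x + padj x \<in> lin \<and> psmult \<i> (x - padj x) \<in> lin}"

lemma lin_Balg [simp]: "y \<in> lin \<Longrightarrow> y \<in> Balg n"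
  by (simp add: lin_def)

lemma lin_hermitian [simp]: "y \<in> lin \<Longrightarrow> padj y = y"
  by (simp add: lin_def cone_hermitian)

lemma lin_add: "x \<in> lin \<Longrightarrow> y \<in> lin \<Longrightarrow> x + y \<in> lin"
  using cone_add[of "- x" "- y"] by (simp add: lin_def cone_add add.commute)

lemma lin_uminus: "x \<in> lin \<Longrightarrow> - x \<in> lin"
  by (simp add: lin_def)

lemma lin_diff: "x \<in> lin \<Longrightarrow> y \<in> lin \<Longrightarrow> x - y \<in> lin"
  using lin_add[of x "- y"] lin_uminus[of y] by simp

lemma lin_scale: "x \<in> lin \<Longrightarrow> psmult (of_real c) x \<in> lin"
  using cone_scale[of x c] cone_scale[of "- x" c] cone_scale[of x "- c"] cone_scale[of "- x" "- c"]
  by (cases "c \<ge> 0") (auto simp: lin_def psmult_uminus_left)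

lemma lin_conj: "x \<in> lin \<Longrightarrow> b \<in> Balg n \<Longrightarrow> padj b \<star> (x \<star> b) \<in> lin"
  using cone_conj[of x b] cone_conj[of "- x" b] by (simp add: lin_def)

lemma lin_jideal: "q \<in> jideal \<Longrightarrow> padj q = q \<Longrightarrow> q \<in> lin"
  unfolding lin_def by (intro CollectI conjI cone_jideal) (simp_all add: jideal_uminus)

lemma nullI: "x \<in> Balg n \<Longrightarrow> x + padj x \<in> lin \<Longrightarrow> psmult \<i> (x - padj x) \<in> lin \<Longrightarrow> x \<in> null"
  by (simp add: null_def)

lemma null_Balg [simp]: "x \<in> null \<Longrightarrow> x \<in> Balg n"
  by (simp add: null_def)

lemma null_lin: "x \<in> lin \<Longrightarrow> x \<in> null"
  using lin_add[of x x] lin_diff[of x x] by (intro nullI) auto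

lemma null_add: "x \<in> null \<Longrightarrow> y \<in> null \<Longrightarrow> x + y \<in> null"
proof -
  assume "x \<in> null" "y \<in> null"
  then have "(x + padj x) + (y + padj y) \<in> lin" "psmult \<i> (x - padj x) + psmult \<i> (y - padj y) \<in> lin"
    by (auto simp only: null_def mem_Collect_eq lin_add)
  then show ?thesis using \<open>x \<in> null\<close> \<open>y \<in> null\<close>
    by (intro nullI) (simp_all add: psmult_add_right[symmetric] algebra_simps)
qed

lemma null_psmult: "x \<in> null \<Longrightarrow> psmult c x \<in> null"
proof -
  assume x: "x \<in> null"
  let ?p = "x + padj x" and ?q = "psmult \<i> (x - padj x)"
  have 1: "psmult (of_real (Re c)) ?p + psmult (of_real (Im c)) ?q \<in> lin"
    "psmult (of_real (Re c)) ?q - psmult (of_real (Im c)) ?p \<in> lin"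
    using x by (auto simp only: null_def mem_Collect_eq lin_add lin_diff lin_scale)
  have c: "c = of_real (Re c) + \<i> * of_real (Im c)" "cnj c = of_real (Re c) - \<i> * of_real (Im c)"
    by (auto simp: complex_eq_iff)
  have 2: "psmult c x + padj (psmult c x) = psmult (of_real (Re c)) ?p + psmult (of_real (Im c)) ?q"
    by (subst c(1), simp only: padj_simps c(2))
      (simp add: psmult_add_left psmult_diff_left psmult_add_right psmult_diff_right mult_ac)
  have 3: "psmult \<i> (psmult c x - padj (psmult c x)) = psmult (of_real (Re c)) ?q - psmult (of_real (Im c)) ?p"
    by (subst c(1), simp only: padj_simps c(2))
      (simp add: psmult_add_left psmult_diff_left psmult_add_right psmult_diff_right psmult_uminus_left distrib_left right_diff_distrib mult_ac
        flip: mult.assoc)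
  show ?thesis using x 1 unfolding 2[symmetric] 3[symmetric] by (intro nullI) auto
qed

lemma null_uminus: "x \<in> null \<Longrightarrow> - x \<in> null"
  using null_psmult[of x "-1"] by (simp add: psmult_minus_one)

lemma null_diff: "x \<in> null \<Longrightarrow> y \<in> null \<Longrightarrow> x - y \<in> null"
  using null_add[of x "- y"] null_uminus[of y] by simp

lemma null_sum: "\<forall>x\<in>S. f x \<in> null \<Longrightarrow> sum f S \<in> null"
  using null_lin[OF lin_jideal[of 0]]
  by (induction S rule: infinite_finite_induct) (auto simp: null_add)

lemma null_split: "x = psmult (1 / 2) (x + padj x) + psmult (- \<i> / 2) (psmult \<i> (x - padj x))"
  by (simp add: fun_eq_iff fun_ops psmult_def field_simps)

lemma null_jideal:
  assumes "q \<in> jideal" shows "q \<in> null"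
proof (rule nullI)
  show "q + padj q \<in> lin" "psmult \<i> (q - padj q) \<in> lin"
    using assms by (intro lin_jideal jideal_add jideal_diff jideal_psmult jideal_padj;
        simp add: psmult_diff_right psmult_uminus_left add.commute)+
qed (use assms jideal_Balg in auto)

text \<open>Polarization of lin_conj with the elements 1 + b and 1 + ib.\<close>

lemma null_lin_wick:
  assumes y: "y \<in> lin" and b: "b \<in> Balg n" shows "y \<star> b \<in> null"
proof -
  have *: "y \<star> b + padj (y \<star> b) \<in> lin" if b: "b \<in> Balg n" for b
  proof -
    have "padj (pone + b) \<star> (y \<star> (pone + b)) - y - padj b \<star> (y \<star> b) \<in> lin"
      using y b by (intro lin_diff lin_conj) auto
    then show ?thesis using y b by (simp add: add.commute)
  qed
  have "psmult \<i> (y \<star> b - padj (y \<star> b)) \<in> lin"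
    using *[of "psmult \<i> b"] y b by (simp add: psmult_diff_right psmult_uminus_left)
  then show ?thesis using * y b by (intro nullI) auto
qed

lemma null_wick_right:
  assumes "x \<in> null" "b \<in> Balg n" shows "x \<star> b \<in> null"
proof -
  let ?p = "x + padj x" and ?q = "psmult \<i> (x - padj x)"
  have "?p \<in> lin" "?q \<in> lin" using assms(1) by (simp_all only: null_def mem_Collect_eq)
  then have "psmult (1 / 2) (?p \<star> b) + psmult (- \<i> / 2) (?q \<star> b) \<in> null"
    using assms(2) by (intro null_add null_psmult null_lin_wick)
  also have "psmult (1 / 2) (?p \<star> b) + psmult (- \<i> / 2) (?q \<star> b)
      = (psmult (1 / 2) ?p + psmult (- \<i> / 2) ?q) \<star> b"
    using assms by simp
  finally show ?thesis using null_split[of x] by simp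
qed

section \<open>Reduction to bidegree (k,k) for integral mu/h\<close>

lemma raise_homog:
  assumes \<mu>: "\<mu> = h * real k" and "j \<le> k" "homog n j f"
  shows "\<exists>g. homog n k g \<and> f - g \<in> jideal"
  using assms(2,3)
proof (induction j arbitrary: f rule: inc_induct)
  case base
  then show ?case by (intro exI[of _ f]) simp
next
  case (step j)
  \<comment> \<open>This is h (k - j), nonzero for j < k. Since \<open>Jmul n f\<close> is f \<star>
    (J - mu) plus \<open>?d\<close> times f, dividing by \<open>?d\<close> replaces f, modulo the
    ideal, by an element of degree j + 1.\<close>
  let ?d = "\<mu> - h * real j"
  have d: "?d \<noteq> 0" using step.hyps h_pos \<mu> by simp
  have f: "f \<in> Balg n" using step.prems by (rule homog_Balg)
  have "Jmul n f = f \<star> (Jpoly n - psmult (h * j) pone)"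
    using step.prems unfolding homog_def by (intro Jmul_wick) blast+
  also have "\<dots> = f \<star> Jmu n \<mu> + psmult (of_real ?d) f"
    using f by (simp add: Jmu_def psmult_diff_left)
  finally have "f - psmult (of_real (1 / ?d)) (Jmul n f) = psmult (- of_real (1 / ?d)) (f \<star> Jmu n \<mu>)"
    using d by (simp only: psmult_add_right psmult_simps of_real_mult[symmetric]) (simp add: psmult_uminus_left)
  also have "\<dots> \<in> jideal" using f by (intro jideal_psmult jidealI')
  finally have 1: "f - psmult (of_real (1 / ?d)) (Jmul n f) \<in> jideal" .
  have "homog n (Suc j) (psmult (of_real (1 / ?d)) (Jmul n f))"
    using step.prems by (intro homog_psmult homog_Jmul)
  from step.IH[OF this] obtain g where g: "homog n k g" "psmult (of_real (1 / ?d)) (Jmul n f) - g \<in> jideal"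
    by blast
  have "f - g \<in> jideal" using jideal_add[OF 1 g(2)] by simp
  then show ?case using g(1) by blast
qed

text \<open>\<open>Jpow n (Suc k)\<close> lies in the ideal because its falling product contains the
  factor mu - h k. It is also a positive combination of cone elements, so minus any one term is the
  sum of the others minus an ideal element.\<close>

lemma zmono_diag_lin:
  assumes \<mu>: "\<mu> = h * real k" and "n \<ge> 1" and K: "mi_on n K" "mdeg n K = Suc k"
  shows "zmono K K \<in> lin"
proof -
  have pos: "\<mu> + h * (real n + 1 - real (Suc k)) > 0"
    using h_pos assms(2) \<mu> by (simp flip: distrib_left)
  obtain S d where S: "finite S" "\<forall>K. K \<in> S \<longleftrightarrow> mi_on n K \<and> mdeg n K = Suc k"
    "\<forall>K\<in>S. d K > (0::real)" "Jpow n (Suc k) = (\<Sum>K\<in>S. psmult (of_real (d K)) (zmono K K))"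
    by (rule Jpow_expand[where n = n and m = "Suc k"])
  have KS: "K \<in> S" using S(2) K by simp
  have diag: "psmult (of_real (d K)) (zmono K K) \<in> cone" if "K \<in> S" for K
    using that S(2,3) pos by (intro cone_scale zmono_diag_cone) (auto simp: less_imp_le)
  have vanish: "(\<Prod>i<Suc k. \<mu> - h * real i) = 0" using \<mu> by simp
  have "Jpow n (Suc k) \<in> jideal"
    using Jpow_mod_jideal[of "Suc k"] unfolding vanish by (simp del: Jpow.simps)
  moreover have "padj (Jpow n (Suc k)) = Jpow n (Suc k)" unfolding S(4) by (simp add: padj_sum)
  ultimately have "- Jpow n (Suc k) \<in> cone" by (intro cone_jideal) (simp_all add: jideal_uminus del: Jpow.simps)
  then have "(\<Sum>K\<in>S - {K}. psmult (of_real (d K)) (zmono K K)) + - Jpow n (Suc k) \<in> cone"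
    using diag by (intro cone_add cone_sum) auto
  also have "(\<Sum>K\<in>S - {K}. psmult (of_real (d K)) (zmono K K)) + - Jpow n (Suc k) = psmult (of_real (- d K)) (zmono K K)"
    unfolding S(4) sum.remove[OF S(1) KS] by (simp add: psmult_uminus_left)
  finally have "psmult (of_real (1 / d K)) (psmult (of_real (- d K)) (zmono K K)) \<in> cone"
    by (rule cone_scale) (use bspec[OF S(3) KS] in simp)
  then have "- zmono K K \<in> cone" using bspec[OF S(3) KS] by (simp add: psmult_minus_one)
  then show ?thesis using zmono_diag_cone[OF K pos] by (simp add: lin_def)
qed

text \<open>Polarization: the square of z^K + c z^L with |c| = 1 lies in the cone, and its diagonal
  terms can be subtracted because they are in \<open>lin\<close>. The values c = 1, -1, i, -i give
  both signs of both Hermitian components.\<close>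

lemma zmono_null_base:
  assumes \<mu>: "\<mu> = h * real k" and "n \<ge> 1"
    and K: "mi_on n K" "mdeg n K = Suc k" and L: "mi_on n L" "mdeg n L = Suc k"
  shows "zmono K L \<in> null"
proof -
  have pos: "\<mu> + h * (real n + 1 - real (Suc k)) > 0"
    using h_pos assms(2) \<mu> by (simp flip: distrib_left)
  let ?z = "\<lambda>K. zmono K (\<lambda>_. 0)"
  have *: "psmult (cnj c) (zmono K L) + psmult c (zmono L K) \<in> cone" if c: "c * cnj c = 1" for c
  proof -
    have "graded n (int (Suc k)) (?z K + psmult c (?z L))" using K L by simp
    then have "(?z K + psmult c (?z L)) \<star> padj (?z K + psmult c (?z L)) \<in> cone"
      using pos by (rule cone_graded_square)
    then have "(?z K + psmult c (?z L)) \<star> padj (?z K + psmult c (?z L)) + (- zmono K K) + (- zmono L L) \<in> cone"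
      using zmono_diag_lin[OF \<mu> assms(2)] K L by (intro cone_add) (auto simp: lin_def)
    also have "(?z K + psmult c (?z L)) \<star> padj (?z K + psmult c (?z L)) + (- zmono K K) + (- zmono L L)
      = psmult (cnj c) (zmono K L) + psmult c (zmono L K)"
      using K L c by (simp add: wick_zmono_right psmult_add_right mult.commute)
    finally show ?thesis .
  qed
  show ?thesis
  proof (rule nullI)
    show "zmono K L + padj (zmono K L) \<in> lin"
      using *[of 1] *[of "-1"] by (simp add: lin_def psmult_minus_one)
    show "psmult \<i> (zmono K L - padj (zmono K L)) \<in> lin"
      using *[of \<i>] *[of "- \<i>"] by (simp add: lin_def psmult_diff_right psmult_uminus_left add.commute)
  qed (use K L in simp)
qed

text \<open>z^K zbar^L of degree m + 1 is a monomial of degree m star-multiplied by z_i zbar_j, up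
  to contraction terms. The product is null because \<open>null\<close> absorbs right factors from
  B, and the contraction terms have degree m.\<close>

lemma zmono_null:
  assumes \<mu>: "\<mu> = h * real k" and "n \<ge> 1" and "Suc k \<le> m"
    and "mi_on n K" "mdeg n K = m" and "mi_on n L" "mdeg n L = m"
  shows "zmono K L \<in> null"
  using assms(3-)
proof (induction m arbitrary: K L rule: dec_induct)
  case base
  then show ?case using zmono_null_base[OF \<mu> assms(2)] by simp
next
  case (step m)
  have "\<exists>i\<le>n. A i > 0" if "mdeg n A = Suc m" for A
    using that unfolding mdeg_def by (metis atMost_iff gr0I sum.neutral Zero_not_Suc)
  then obtain i j where i: "i \<le> n" "K i > 0" and j: "j \<le> n" "L j > 0"
    using step.prems by metis
  let ?K = "msub K (unitmi i)" and ?L = "msub L (unitmi j)" and ?Z = "\<lambda>_. 0 :: nat"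
  have KL: "mi_on n ?K" "mi_on n ?L" "mdeg n ?K = m" "mdeg n ?L = m"
    using mdeg_msub_unitmi[of i n K, OF i] mdeg_msub_unitmi[of j n L, OF j] step.prems
    by (auto simp: mi_on_def msub_def)
  have K: "K = (\<lambda>l. ?K l + unitmi i l)" using i by (auto simp: fun_eq_iff msub_def unitmi_def)
  have L: "L = (\<lambda>l. ?L l + unitmi j l)" using j by (auto simp: fun_eq_iff msub_def unitmi_def)
  let ?MS = "{M. \<forall>l. M l \<le> ?L l \<and> M l \<le> unitmi i l}"
  let ?t = "\<lambda>M. psmult (contr ?L (unitmi i) M) (zmono (\<lambda>l. ?K l + unitmi i l - M l) (\<lambda>l. ?L l + unitmi j l - M l))"
  \<comment> \<open>z_i occurs only once in the right factor, so at most one contraction is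
    possible.\<close>
  have MS: "M = ?Z \<or> M = unitmi i" if "M \<in> ?MS" for M
  proof (cases "M i = 0")
    case True
    then have "M l = 0" for l using that by (cases "l = i") (auto simp: unitmi_def dest: spec[of _ l])
    then show ?thesis by auto
  next
    case False
    then have "M l = unitmi i l" for l using that by (cases "l = i") (auto simp: unitmi_def dest: spec[of _ l])
    then show ?thesis by auto
  qed
  then have "finite ?MS" by (intro finite_subset[of ?MS "{?Z, unitmi i}"]) auto
  moreover have "?Z \<in> ?MS" by simp
  ultimately have sum: "zmono ?K ?L \<star> zmono (unitmi i) (unitmi j) = zmono K L + (\<Sum>M\<in>?MS - {?Z}. ?t M)"
    unfolding wick_mono by (subst sum.remove[of _ ?Z]) (simp_all flip: K L)
  have "?t M \<in> null" if M: "M \<in> ?MS - {?Z}" for M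
  proof (rule null_psmult)
    have Mi: "M = unitmi i" using M MS by blast
    then have Li: "?L i > 0" using M by (auto simp: unitmi_def dest: spec[of _ i])
    let ?L' = "msub ?L (unitmi i)"
    have "(\<lambda>l. ?K l + unitmi i l - M l) = ?K" by (simp add: Mi)
    moreover have "(\<lambda>l. ?L l + unitmi j l - M l) = (\<lambda>l. ?L' l + unitmi j l)"
      using Li by (auto simp: Mi fun_eq_iff msub_def unitmi_def)
    moreover have "mi_on n ?L'" "mdeg n ?L' + 1 = m"
      using mdeg_msub_unitmi[of i n ?L] Li i KL by (auto simp: mi_on_def msub_def)
    ultimately show "zmono (\<lambda>l. ?K l + unitmi i l - M l) (\<lambda>l. ?L l + unitmi j l - M l) \<in> null"
      using KL j by (simp add: step.IH)
  qed
  moreover have "zmono ?K ?L \<star> zmono (unitmi i) (unitmi j) \<in> null"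
    using KL i j by (intro null_wick_right step.IH) auto
  ultimately have "zmono ?K ?L \<star> zmono (unitmi i) (unitmi j) - (\<Sum>M\<in>?MS - {?Z}. ?t M) \<in> null"
    by (intro null_diff null_sum) auto
  then show ?case unfolding sum by simp
qed

lemma homog_mod_null:
  assumes \<mu>: "\<mu> = h * real k" and "n \<ge> 1" and f: "f \<in> Balg n"
  shows "\<exists>g. homog n k g \<and> f - g \<in> null"
proof -
  have "graded n 0 f" using f by (simp add: Balg_graded)
  then show ?thesis
  proof (induction rule: graded_induct)
    case (zmono K L)
    show ?case
    proof (cases "mdeg n L \<le> k")
      case True
      then show ?thesis
        using zmono raise_homog[OF \<mu> True, of "zmono K L"] null_jideal by auto
    next
      case False
      then have "zmono K L \<in> null" using zmono_null[OF \<mu> assms(2), of "mdeg n L" K L] zmono by simp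
      then show ?thesis by (intro exI[of _ 0]) simp
    qed
  next
    case zero
    show ?case using null_jideal[of 0] by (intro exI[of _ 0]) simp
  next
    case (add f f')
    then obtain g g' where "homog n k g" "f - g \<in> null" "homog n k g'" "f' - g' \<in> null" by blast
    then show ?case using null_add[of "f - g" "f' - g'"]
      by (intro exI[of _ "g + g'"]) (simp add: algebra_simps)
  next
    case (psmult c f)
    then obtain g where "homog n k g" "f - g \<in> null" by blast
    then show ?case using null_psmult[of "f - g" c]
      by (intro exI[of _ "psmult c g"]) (simp add: psmult_diff_right)
  qed
qed

text \<open>For |L| = |B| the derivative along L kills z^B unless L = B. Hence the matrix of g on
  degree k is its coefficient matrix scaled by the squared norms of the monomials.\<close>

lemma homog_matrix_element:
  assumes "homog n k g" and A: "mi_on n A" "mdeg n A = k" and B: "mi_on n B" "mdeg n B = k"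
  shows "finner n h (hbase A) (frep n h g (hbase B)) = g A B * of_real (hwt A) * of_real (hwt B)"
  using assms(1)
proof (induction rule: homog_induct)
  case (zmono K L)
  have X: "mi_on n (\<lambda>i. K i + B i - L i)" using zmono B by (simp add: mi_on_def)
  show ?case
  proof (cases "L = B")
    case True
    then have "(\<lambda>i. K i + B i - L i) = K" "ffact L B = hwt B"
      by (auto simp: ffact_def hwt_def)
    then show ?thesis using A B zmono True by (simp add: frep_mono finner_hbase) (simp add: zmono_def)
  next
    case False
    then have "ffact L B = 0" using ffact_eq_0[of L B] mindex_le_antisym[of n L B] zmono B by auto
    then show ?thesis using False A B zmono by (simp add: frep_mono) (simp add: zmono_def)
  qed
qed (use A B in \<open>(simp, simp add: fun_ops psmult_def algebra_simps)+\<close>)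

lemma finner_sum_right:
  "\<phi> \<in> fock n \<Longrightarrow> \<forall>x\<in>S. f x \<in> fock n \<Longrightarrow> finner n h \<phi> (\<Sum>x\<in>S. f x) = (\<Sum>x\<in>S. finner n h \<phi> (f x))"
  by (induction S rule: infinite_finite_induct) auto

lemma finner_sum_left:
  "\<phi> \<in> fock n \<Longrightarrow> \<forall>x\<in>S. f x \<in> fock n \<Longrightarrow> finner n h (\<Sum>x\<in>S. f x) \<phi> = (\<Sum>x\<in>S. finner n h (f x) \<phi>)"
  by (induction S rule: infinite_finite_induct) auto

lemma frep_sum_right:
  "g \<in> polys n \<Longrightarrow> \<forall>x\<in>S. f x \<in> fock n \<Longrightarrow> frep n h g (\<Sum>x\<in>S. f x) = (\<Sum>x\<in>S. frep n h g (f x))"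
  by (induction S rule: infinite_finite_induct) auto

lemma homog_positive_cone:
  assumes \<mu>: "\<mu> = h * real k" and g: "homog n k g" "padj g = g"
    and pos: "\<And>\<psi>. \<psi> \<in> fock n \<Longrightarrow> frep n h (Jmu n \<mu>) \<psi> = 0 \<Longrightarrow> 0 \<le> finner n h \<psi> (frep n h g \<psi>)"
  shows "g \<in> cone"
proof -
  define S where "S = fst ` psupp g \<union> snd ` psupp g"
  have gp: "g \<in> polys n" using g(1) by (simp add: homog_Balg)
  then have fin: "finite S" by (simp add: S_def polysD_finite)
  have S: "mi_on n A" "mdeg n A = k" if "A \<in> S" for A
    using that gp g(1) unfolding S_def homog_def polys_def psupp_def by auto
  have "0 \<le> (\<Sum>A\<in>S. \<Sum>B\<in>S. cnj (v A) * g A B * v B)" for v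
  proof -
    \<comment> \<open>Dividing by \<open>hwt A\<close> cancels the two weights in
      \<open>homog_matrix_element\<close>, so the expectation in \<psi> becomes the bare form of the
      coefficient matrix.\<close>
    define u where "u A = hsmult (v A / of_real (hwt A)) (hbase A)" for A
    define \<psi> where "\<psi> = (\<Sum>A\<in>S. u A)"
    have u: "u A \<in> fock n" if "A \<in> S" for A using S(1)[OF that] by (simp add: u_def)
    then have \<psi>: "\<psi> \<in> fock n" by (simp add: \<psi>_def)
    have "frep n h (Jmu n \<mu>) (u A) = 0" if "A \<in> S" for A
      using S[OF that] by (simp add: u_def Jmu_def frep_Jpoly_hbase \<mu>)
    then have "frep n h (Jmu n \<mu>) \<psi> = 0" using u by (simp add: \<psi>_def frep_sum_right)
    with \<psi> have "0 \<le> finner n h \<psi> (frep n h g \<psi>)" by (rule pos)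
    also have "\<dots> = (\<Sum>A\<in>S. \<Sum>B\<in>S. finner n h (u A) (frep n h g (u B)))"
    proof -
      have 1: "finner n h \<psi> (frep n h g \<psi>) = (\<Sum>A\<in>S. finner n h (u A) (frep n h g \<psi>))"
        using u \<psi> gp by (subst (1) \<psi>_def, subst finner_sum_left) auto
      have 2: "frep n h g \<psi> = (\<Sum>B\<in>S. frep n h g (u B))"
        using u gp by (simp add: \<psi>_def frep_sum_right)
      show ?thesis unfolding 1 unfolding 2 using u gp by (simp add: finner_sum_right)
    qed
    also have "\<dots> = (\<Sum>A\<in>S. \<Sum>B\<in>S. cnj (v A) * g A B * v B)"
    proof (intro sum.cong refl)
      fix A B assume "A \<in> S" "B \<in> S"
      then show "finner n h (u A) (frep n h g (u B)) = cnj (v A) * g A B * v B"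
        using homog_matrix_element[OF g(1), of A B] S gp hwt_pos[of A] hwt_pos[of B] by (simp add: u_def)
    qed
    finally show ?thesis .
  qed
  moreover have "g B A = cnj (g A B)" for A B using g(2) by (metis padj_def)
  ultimately obtain m :: nat and a where a: "\<forall>A\<in>S. \<forall>B\<in>S. g A B = (\<Sum>j<m. a j A * cnj (a j B))"
    using psd_rank_one_decomposition[OF fin, of g] by blast
  \<comment> \<open>Each rank-one vector becomes a holomorphic polynomial of degree k. In
    \<open>G j \<star> padj (G j)\<close> nothing is contracted, so its coefficients are exactly the
    rank-one matrix; the condition of \<open>cone_graded_square\<close> is h (n + 1) > 0
    here.\<close>
  define G where "G j = (\<Sum>A\<in>S. psmult (a j A) (zmono A (\<lambda>_. 0)))" for j
  have G: "graded n (int k) (G j)" for j unfolding G_def using S by (intro graded_sum) auto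
  have "G j \<star> padj (G j) \<in> cone" for j
    using G by (rule cone_graded_square) (use h_pos in \<open>simp add: \<mu> flip: distrib_left\<close>)
  then have "(\<Sum>j<m. G j \<star> padj (G j)) \<in> cone" by (intro cone_sum) simp
  also have "(\<Sum>j<m. G j \<star> padj (G j)) = (\<Sum>j<m. \<Sum>A\<in>S. \<Sum>B\<in>S. psmult (a j A * cnj (a j B)) (zmono A B))"
  proof (intro sum.cong refl)
    fix j
    have "G j \<star> padj (G j) = (\<Sum>A\<in>S. psmult (a j A) (zmono A (\<lambda>_. 0)) \<star> padj (G j))"
      using S gradedD[OF G] by (subst (1) G_def, intro wick_sum_left) auto
    also have "\<dots> = (\<Sum>A\<in>S. \<Sum>B\<in>S. psmult (a j A * cnj (a j B)) (zmono A B))"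
      using S by (intro sum.cong refl)
        (simp add: G_def padj_sum wick_sum_right wick_zmono_right psmult_sum_right mult.commute)
    finally show "G j \<star> padj (G j) = (\<Sum>A\<in>S. \<Sum>B\<in>S. psmult (a j A * cnj (a j B)) (zmono A B))" .
  qed
  also have "\<dots> = (\<Sum>A\<in>S. \<Sum>B\<in>S. \<Sum>j<m. psmult (a j A * cnj (a j B)) (zmono A B))"
    by (subst sum.swap, intro sum.cong refl, subst sum.swap) (rule refl)
  also have "\<dots> = (\<Sum>A\<in>S. \<Sum>B\<in>S. psmult (g A B) (zmono A B))"
  proof (intro sum.cong refl)
    fix A B assume "A \<in> S" "B \<in> S"
    then show "(\<Sum>j<m. psmult (a j A * cnj (a j B)) (zmono A B)) = psmult (g A B) (zmono A B)"
      using a by (simp add: fun_eq_iff psmult_def sum_fun_apply sum_distrib_right)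
  qed
  also have "\<dots> = (\<Sum>(A, B)\<in>S \<times> S. psmult (g A B) (zmono A B))" by (rule sum.cartesian_product)
  also have "\<dots> = g" using fin by (intro cpoly_expand[symmetric]) (force simp: S_def)+
  finally show ?thesis .
qed

lemma Rred_subset_cone:
  assumes "n \<ge> 1" "\<mu> \<ge> 0" and f: "f \<in> Rred n h \<mu>" shows "f \<in> cone"
proof (cases "\<exists>k::nat. \<mu> = h * real k")
  case False
  then show ?thesis using cone_nonintegral[OF assms(1,2)] f by (auto simp: Rred_def)
next
  case True
  then obtain k :: nat where \<mu>: "\<mu> = h * real k" by blast
  have fB: "f \<in> Balg n" "padj f = f" using f by (auto simp: Rred_def)
  obtain g where g: "homog n k g" "f - g \<in> null" using homog_mod_null[OF \<mu> assms(1) fB(1)] by blast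
  \<comment> \<open>The homogeneous representative need not be Hermitian. Its Hermitian part still
    differs from f by an element of \<open>lin\<close>, as f itself is Hermitian.\<close>
  define g' where "g' = psmult (1 / 2) (g + padj g)"
  have g': "homog n k g'" "padj g' = g'" using g(1) by (auto simp: g'_def add.commute)
  have "(f - g) + padj (f - g) \<in> lin" using g(2) by (simp only: null_def mem_Collect_eq)
  then have "psmult (of_real (1 / 2)) ((f - g) + padj (f - g)) \<in> lin" by (rule lin_scale)
  also have "psmult (of_real (1 / 2)) ((f - g) + padj (f - g)) = f - g'"
    using fB(2) by (simp add: g'_def fun_eq_iff fun_ops psmult_def field_simps)
  finally have lin: "f - g' \<in> cone" "- (f - g') \<in> cone" by (auto simp only: lin_def mem_Collect_eq)
  have "g' \<in> cone"
  proof (rule homog_positive_cone[OF \<mu> g'])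
    fix \<psi> assume \<psi>: "\<psi> \<in> fock n" "frep n h (Jmu n \<mu>) \<psi> = 0"
    \<comment> \<open>g' is f plus \<open>- (f - g')\<close>; the second summand is in the cone,
      hence nonnegative on admissible states by the easy inclusion. So g' inherits membership in
      \<open>Rred\<close> and can be tested on vector states.\<close>
    have "0 \<le> \<omega> g'" if \<omega>: "is_state n h \<omega>" "\<omega> (Jmu n \<mu> \<star> Jmu n \<mu>) = 0" for \<omega>
    proof -
      have "- (f - g') \<in> Balg n" using fB homog_Balg[OF g'(1)] by simp
      then have "\<omega> (f + - (f - g')) = \<omega> f + \<omega> (- (f - g'))"
        using \<omega>(1) fB(1) unfolding is_state_def by blast
      moreover have "0 \<le> \<omega> f" "0 \<le> \<omega> (- (f - g'))"
        using \<omega> f lin(2) cone_subset_Rred unfolding Rred_def by blast+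
      ultimately show ?thesis by (simp add: less_eq_complex_def)
    qed
    then have "g' \<in> Rred n h \<mu>" using homog_Balg[OF g'(1)] g'(2) unfolding Rred_def by blast
    then show "0 \<le> finner n h \<psi> (frep n h g' \<psi>)" using Rred_expectation[OF _ \<psi>, of g'] by simp
  qed
  then show ?thesis using cone_add[OF lin(1), of g'] by simp
qed

end

theorem theorem4p7:
  fixes n :: nat and h \<mu> :: real
  assumes "n \<ge> 1" and "h > 0" and "\<mu> \<ge> 0"
  shows "Rred n h \<mu> =
    {p + q | p q. p \<in> sos n h \<and> q \<in> star_ideal n h (Jmu n \<mu>) \<and> padj q = q}"
proof -
  interpret wick_reduction n h \<mu> by unfold_locales (rule assms(2))
  have "Rred n h \<mu> = cone"
    using Rred_subset_cone[OF assms(1,3)] cone_subset_Rred by blast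
  then show ?thesis by (simp add: cone_def star_ideal_eq)
qed

end
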